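(* Let $G$ be a graph on the vertex set $[n]=\{1,\dots,n\}$ and let $K$ be a field. Then the stable set ring $K[G]$ is quadratic if and only if, for every replication graph $H$ of any induced subgraph of $G$ and every integer $k \ge \chi(H)$, all $k$-colorings of $H$ are Kempe equivalent.
   Context: Graphs are finite and simple. Colorings: a $k$-coloring of a graph $H$ with vertex set $V$ is a map $f: V \to [k]$ with $f(u)\ne f(v)$ for every edge $\{u,v\}$ of $H$ (not necessarily surjective); $\chi(H)$ is the smallest $k$ for which $H$ has a $k$-coloring. Kempe equivalence: given a $k$-coloring $f$ of $H$, integers $1\le i<j\le k$, and a connected component $C$ of the subgraph of $H$ induced on $f^{-1}(i)\cup f^{-1}(j)$, the $k$-coloring $g$ which agrees with $f$ outside $C$ and exchanges the colors $i$ and $j$ on the vertices of $C$ is said to be obtained from $f$ by a Kempe switching. Two $k$-colorings $f,g$ of $H$ are Kempe equivalent if there is a sequence $f_0=f,f_1,\dots,f_s=g$ of $k$-colorings of $H$ such that each $f_i$ is obtained from $f_{i-1}$ by a Kempe switching. Replication graphs: for a graph $G$ on $[n]$ and $\mathbf a=(a_1,\dots,a_n)\in\mathbb Z_{\ge 0}^n$, let $G_{\mathbf a}$ be the graph obtained from $G$ by replacing each vertex $i$ with a complete graph $G^{(i)}$ on $a_i$ vertices (deleting $i$ if $a_i=0$), and joining every vertex of $G^{(i)}$ to every vertex of $G^{(j)}$ whenever $\{i,j\}$ is an edge of $G$. If all $a_i$ are positive, $G_{\mathbf a}$ is called a replication graph of $G$. The replication graphs of induced subgraphs of $G$ are exactly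 the graphs $G_{\mathbf a}$ with $\mathbf a\in\mathbb Z_{\ge0}^n$. Stable set ring: a stable set of $G$ is a subset $S\subset[n]$ containing no two adjacent vertices (in particular $\emptyset$ and singletons are stable). Let $S_1,\dots,S_m$ be all the stable sets of $G$. The stable set ring of $G$ is the subalgebra $K[G]=K[\,s\prod_{j\in S_1}t_j,\dots,s\prod_{j\in S_m}t_j\,]$ of the polynomial ring $K[t_1,\dots,t_n,s]$. Let $K[x_1,\dots,x_m]$ be the polynomial ring with $\deg x_i=1$, and let the stable set ideal $I_G$ be the kernel of the surjective $K$-algebra homomorphism $K[x_1,\dots,x_m]\to K[G]$, $x_i\mapsto s\prod_{j\in S_i}t_j$. The ring $K[G]$ is called quadratic if $I_G$ is generated by quadratic (homogeneous degree 2) binomials; by convention this includes the case $I_G=\{0\}$. *)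

theory Defs
  imports
    "HOL-Algebra.Generated_Rings"
    "HOL-Algebra.AbelCoset"
    "HOL-Algebra.Ideal"
    "HOL-Combinatorics.Transposition"
    "HOL-Library.FuncSet"
    "HOL-Library.Poly_Mapping"
    "Graph_Theory.Graph_Theory"
begin

text \<open>
  Finite simple graphs are the symmetric loopfree digraphs without parallel arcs of the locale
  \<^locale>\<open>pair_graph\<close>: an edge \<open>{u, v}\<close> is represented by the two arcs \<open>(u, v)\<close> and \<open>(v, u)\<close>.
\<close>

section \<open>Colorings and Kempe equivalence\<close>

text \<open>
  Colorings are extensional (\<open>undefined\<close> outside the vertex set), so that equality of
  HOL functions is equality of maps \<open>V \<rightarrow> [k]\<close>.
\<close>

definition colorings :: "'v pair_pre_digraph \<Rightarrow> nat \<Rightarrow> ('v \<Rightarrow> nat) set" where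
  "colorings H k = {f \<in> pverts H \<rightarrow>\<^sub>E {1..k}. \<forall>(u, v) \<in> parcs H. f u \<noteq> f v}"

definition chromatic_number :: "'v pair_pre_digraph \<Rightarrow> nat" where
  "chromatic_number H = (LEAST k. colorings H k \<noteq> {})"

text \<open>
  On a symmetric digraph the strongly connected components are the connected components of the
  underlying undirected graph; \<^const>\<open>pre_digraph.sccs_verts\<close> is the set of their (nonempty)
  vertex sets.
\<close>

definition components :: "'v pair_pre_digraph \<Rightarrow> 'v set \<Rightarrow> 'v set set" where
  "components H A = pre_digraph.sccs_verts (with_proj H \<restriction> A)"

definition kempe_switching :: "'v pair_pre_digraph \<Rightarrow> nat \<Rightarrow> ('v \<Rightarrow> nat) \<Rightarrow> ('v \<Rightarrow> nat) \<Rightarrow> bool" where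
  "kempe_switching H k f g \<longleftrightarrow> f \<in> colorings H k \<and> g \<in> colorings H k \<and>
    (\<exists>i j C. 1 \<le> i \<and> i < j \<and> j \<le> k \<and>
      C \<in> components H {v \<in> pverts H. f v = i \<or> f v = j} \<and>
      g = (\<lambda>v. if v \<in> C then transpose i j (f v) else f v))"

definition kempe_equivalent :: "'v pair_pre_digraph \<Rightarrow> nat \<Rightarrow> ('v \<Rightarrow> nat) \<Rightarrow> ('v \<Rightarrow> nat) \<Rightarrow> bool" where
  "kempe_equivalent H k f g \<longleftrightarrow> f \<in> colorings H k \<and> g \<in> colorings H k \<and> (kempe_switching H k)\<^sup>*\<^sup>* f g"


section \<open>Replication graphs\<close>

text \<open>The clique replacing the vertex \<open>i\<close> has the vertices \<open>(i, 0), \<dots>, (i, a i - 1)\<close>.\<close>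

definition replicate_graph :: "'v pair_pre_digraph \<Rightarrow> ('v \<Rightarrow> nat) \<Rightarrow> ('v \<times> nat) pair_pre_digraph" where
  "replicate_graph G a =
    (let V = (SIGMA i : pverts G. {..<a i}) in
      \<lparr> pverts = V,
        parcs = {((i, p), (j, q)) | i p j q. (i, p) \<in> V \<and> (j, q) \<in> V \<and>
                   (i = j \<and> p \<noteq> q \<or> (i, j) \<in> parcs G)} \<rparr>)"

definition is_replication_graph :: "('v \<times> nat) pair_pre_digraph \<Rightarrow> 'v pair_pre_digraph \<Rightarrow> bool" where
  "is_replication_graph H G \<longleftrightarrow> (\<exists>a. (\<forall>i \<in> pverts G. 0 < a i) \<and> H = replicate_graph G a)"


section \<open>Polynomial rings\<close>

text \<open>
  Polynomials are finitely supported maps from monomials to coefficients, monomials being finitely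
  supported maps from indeterminates to exponents; \<open>mpoly_ring X\<close> is \<open>K[x | x \<in> X]\<close>.
\<close>

type_synonym ('x, 'k) mpoly = "('x \<Rightarrow>\<^sub>0 nat) \<Rightarrow>\<^sub>0 'k"

definition mpoly_ring :: "'x set \<Rightarrow> ('x, 'k::field) mpoly ring" where
  "mpoly_ring X =
    \<lparr> carrier = {p. \<forall>m \<in> Poly_Mapping.keys p. Poly_Mapping.keys m \<subseteq> X},
      monoid.mult = (*), one = 1, zero = 0, add = (+) \<rparr>"

definition mconst :: "'k::field \<Rightarrow> ('x, 'k) mpoly" where
  "mconst c = Poly_Mapping.single 0 c"

definition mmonom :: "('x \<Rightarrow>\<^sub>0 nat) \<Rightarrow> ('x, 'k::field) mpoly" where
  "mmonom m = Poly_Mapping.single m 1"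

definition mvar :: "'x \<Rightarrow> ('x, 'k::field) mpoly" where
  "mvar x = mmonom (Poly_Mapping.single x 1)"

definition monom_deg :: "('x \<Rightarrow>\<^sub>0 nat) \<Rightarrow> nat" where
  "monom_deg m = (\<Sum>x \<in> Poly_Mapping.keys m. Poly_Mapping.lookup m x)"

text \<open>The \<open>K\<close>-algebra homomorphism sending each indeterminate \<open>x\<close> to \<open>\<phi> x\<close>.\<close>

definition mpoly_subst :: "('x \<Rightarrow> ('y, 'k::field) mpoly) \<Rightarrow> ('x, 'k) mpoly \<Rightarrow> ('y, 'k) mpoly" where
  "mpoly_subst \<phi> p =
    (\<Sum>m \<in> Poly_Mapping.keys p. mconst (Poly_Mapping.lookup p m) *
       (\<Prod>x \<in> Poly_Mapping.keys m. \<phi> x ^ Poly_Mapping.lookup m x))"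

definition generated_subalgebra :: "'x set \<Rightarrow> ('x, 'k::field) mpoly set \<Rightarrow> ('x, 'k) mpoly ring" where
  "generated_subalgebra X A =
    (mpoly_ring X)\<lparr> carrier := generate_ring (mpoly_ring X) (range mconst \<union> A) \<rparr>"

definition quadratic_binomials :: "'x set \<Rightarrow> ('x, 'k::field) mpoly set" where
  "quadratic_binomials X = {mmonom u - mmonom v | u v.
    Poly_Mapping.keys u \<subseteq> X \<and> Poly_Mapping.keys v \<subseteq> X \<and>
    monom_deg u = 2 \<and> monom_deg v = 2 \<and> u \<noteq> v}"


section \<open>The stable set ring\<close>

definition stable_sets :: "'v pair_pre_digraph \<Rightarrow> 'v set set" where
  "stable_sets G = {S. S \<subseteq> pverts G \<and> (\<forall>u \<in> S. \<forall>v \<in> S. (u, v) \<notin> parcs G)}"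

datatype 'v ts_var = Tvar 'v | Svar

definition stable_gen :: "'v set \<Rightarrow> ('v ts_var, 'k::field) mpoly" where
  "stable_gen S = mvar Svar * (\<Prod>j \<in> S. mvar (Tvar j))"

definition stable_set_ring :: "'v pair_pre_digraph \<Rightarrow> ('v ts_var, 'k::field) mpoly ring" where
  "stable_set_ring G =
    generated_subalgebra (insert Svar (Tvar ` pverts G)) (stable_gen ` stable_sets G)"

text \<open>
  The indeterminates \<open>x\<^sub>1, \<dots>, x\<^sub>m\<close> are indexed by the stable sets \<open>S\<^sub>1, \<dots>, S\<^sub>m\<close> themselves.
\<close>

definition stable_set_ideal :: "'v pair_pre_digraph \<Rightarrow> ('v set, 'k::field) mpoly set" where
  "stable_set_ideal G =
    a_kernel (mpoly_ring (stable_sets G)) (stable_set_ring G) (mpoly_subst stable_gen)"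

text \<open>
  The field is passed as a type argument.  The zero ideal is generated by \<open>B = {}\<close>.
\<close>

definition quadratic_stable_set_ring :: "'k::field itself \<Rightarrow> 'v pair_pre_digraph \<Rightarrow> bool" where
  "quadratic_stable_set_ring _ G \<longleftrightarrow>
    (\<exists>B \<subseteq> quadratic_binomials (stable_sets G).
      (stable_set_ideal G :: ('v set, 'k) mpoly set) = Idl\<^bsub>mpoly_ring (stable_sets G)\<^esub> B)"

end

theory Submission
  imports Defs "HOL-Combinatorics.Permutations"
begin

text \<open>
  Two monomials in the indeterminates \<open>x\<^sub>S\<close> have the same image in the stable set ring if and only if they
  have the same degree \<open>k\<close> and contain each vertex \<open>j\<close> of \<open>G\<close> equally often, say \<open>a\<^sub>j\<close> times.  The monomials of
  such a fibre are the \<open>k\<close>-colorings of the replication graph with clique sizes \<open>a\<^sub>j\<close>, up to permuting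
  the colors and the vertices within each clique: a monomial lists the stable sets of \<open>G\<close> below the color
  classes.  The theorem compares connectedness of fibres with connectedness of sets of colorings.

  On the algebraic side, the stable set ideal is spanned by the differences of monomials in a common
  fibre, and the ideal generated by its quadratic binomials is spanned by the differences of
  monomials that are connected by quadratic moves, each of which replaces two factors by two others
  with the same image.  Either ideal consists of the polynomials on which every weight function
  invariant under the respective relation sums to zero (\<open>null_ideal\<close>), and this description
  recovers the relation from the ideal.  So \<open>K[G]\<close> is quadratic if and only if quadratic moves connect
  every fibre (\<open>quadratic_iff_fibres_connected\<close>).

  On the combinatorial side, Kempe equivalence is generated by arbitrary recolorings that only
  involve vertices of two colors and only those two colors: the vertices where the two colorings
  differ form a union of Kempe components, which can be switched one after the other
  (\<open>two_color_change_imp_kempe_equivalent\<close>).  Such a recoloring changes two factors of the monomial, hence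
  is a quadratic move.  Conversely a quadratic move lifts to a recoloring of two color classes
  (\<open>quadratic_move_lift\<close>).  Lifting loses only the choice of a coloring with a given monomial, which is
  harmless: permuting colors and permuting vertices within cliques are compositions of
  two-colored recolorings (\<open>equal_monomials_kempe_equivalent\<close>).
\<close>

abbreviation keys :: "('a \<Rightarrow>\<^sub>0 'b::zero) \<Rightarrow> 'a set" where
  "keys \<equiv> Poly_Mapping.keys"

abbreviation lookup :: "('a \<Rightarrow>\<^sub>0 'b::zero) \<Rightarrow> 'a \<Rightarrow> 'b" where
  "lookup \<equiv> Poly_Mapping.lookup"

abbreviation single :: "'a \<Rightarrow> 'b \<Rightarrow> ('a \<Rightarrow>\<^sub>0 'b::zero)" where
  "single \<equiv> Poly_Mapping.single"

section \<open>Linear extension\<close>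

text \<open>
  Evaluating a finitely supported map at a weight function \<open>\<phi>\<close>.  Three kinds of data are read off
  in this way: the degree of a monomial, the exponents of its image in the stable set ring, and, for
  a polynomial, the sum of its coefficients over a set of monomials.
\<close>

definition lin_ext :: "('a \<Rightarrow> 'b) \<Rightarrow> ('a \<Rightarrow>\<^sub>0 'b) \<Rightarrow> 'b::comm_semiring_1" where
  "lin_ext \<phi> p = (\<Sum>x \<in> keys p. lookup p x * \<phi> x)"

lemma lin_ext_zero [simp]: "lin_ext \<phi> 0 = 0"
  by (simp add: lin_ext_def)

lemma lin_ext_add [simp]: "lin_ext \<phi> (p + q) = lin_ext \<phi> p + lin_ext \<phi> q"
  unfolding lin_ext_def
  using setsum_keys_plus_distrib[of "\<lambda>x c. c * \<phi> x" p q] by (simp add: distrib_right)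

lemma lin_ext_single [simp]: "lin_ext \<phi> (single x c) = c * \<phi> x"
  by (cases "c = 0") (simp_all add: lin_ext_def)

lemma lin_ext_sum: "lin_ext \<phi> (\<Sum>x \<in> A. f x) = (\<Sum>x \<in> A. lin_ext \<phi> (f x))"
  by (induction A rule: infinite_finite_induct) simp_all

lemma lin_ext_uminus [simp]: "lin_ext \<phi> (- p) = - lin_ext \<phi> (p :: 'a \<Rightarrow>\<^sub>0 'b::comm_ring_1)"
  using lin_ext_add[of \<phi> p "- p"] by (simp add: eq_neg_iff_add_eq_0 add.commute)

lemma lin_ext_diff [simp]:
  "lin_ext \<phi> (p - q) = lin_ext \<phi> p - lin_ext \<phi> (q :: 'a \<Rightarrow>\<^sub>0 'b::comm_ring_1)"
  using lin_ext_add[of \<phi> p "- q"] by simp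

lemma poly_mapping_sum_single: "p = (\<Sum>x \<in> keys p. single x (lookup p x))"
proof (rule poly_mapping_eqI)
  fix y
  have "lookup (\<Sum>x \<in> keys p. single x (lookup p x)) y
      = (\<Sum>x \<in> keys p. if y = x then lookup p x else 0)"
    by (simp add: lookup_sum lookup_single when_def eq_commute)
  also have "\<dots> = lookup p y"
    by (simp add: sum.delta' in_keys_iff)
  finally show "lookup p y = lookup (\<Sum>x \<in> keys p. single x (lookup p x)) y" by simp
qed

text \<open>
  Multiplying by a monomial \<open>w\<close> amounts to shifting the weights by \<open>w\<close>; this is what makes sets of
  polynomials defined by vanishing conditions ideals, as soon as the weights are stable under shifts.
\<close>

lemma lin_ext_times:
  "lin_ext \<phi> (p * q) = (\<Sum>w \<in> keys q. lookup q w * lin_ext (\<lambda>m. \<phi> (m + w)) p)"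
proof -
  have "p * q = (\<Sum>m \<in> keys p. single m (lookup p m)) * (\<Sum>w \<in> keys q. single w (lookup q w))"
    by (simp add: poly_mapping_sum_single[symmetric])
  also have "\<dots> = (\<Sum>w \<in> keys q. \<Sum>m \<in> keys p. single (m + w) (lookup p m * lookup q w))"
    by (subst sum.swap) (simp add: sum_product mult_single)
  finally show ?thesis
    by (simp add: lin_ext_sum lin_ext_def[of "\<lambda>m. \<phi> (m + _)"] sum_distrib_left mult_ac)
qed

lemma lookup_sum_single_image:
  "lookup (\<Sum>x \<in> keys p. single (h x) (lookup p x)) y = lin_ext (\<lambda>x. 1 when h x = y) p"
  by (simp add: lookup_sum lookup_single lin_ext_def mult_when)

section \<open>Polynomial rings\<close>

lemma mpoly_ring_simps [simp]:
  "p \<in> carrier (mpoly_ring X) \<longleftrightarrow> (\<forall>m \<in> keys p. keys m \<subseteq> X)"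
  "monoid.mult (mpoly_ring X) = (*)" "one (mpoly_ring X) = 1"
  "zero (mpoly_ring X) = 0" "add (mpoly_ring X) = (+)"
  by (simp_all add: mpoly_ring_def)

lemma mpoly_carrier_add:
  "p \<in> carrier (mpoly_ring X) \<Longrightarrow> q \<in> carrier (mpoly_ring X) \<Longrightarrow> p + q \<in> carrier (mpoly_ring X)"
  using Poly_Mapping.keys_add[of p q] by auto

lemma mpoly_carrier_uminus:
  "p \<in> carrier (mpoly_ring X) \<Longrightarrow> - p \<in> carrier (mpoly_ring X)"
  by (simp add: in_keys_iff)

lemma mpoly_carrier_mult:
  assumes "p \<in> carrier (mpoly_ring X)" "q \<in> carrier (mpoly_ring X)"
  shows "p * q \<in> carrier (mpoly_ring X)"
proof -
  have "keys m \<subseteq> X" if m: "m \<in> keys (p * q)" for m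
  proof -
    obtain a b where "m = a + b" "a \<in> keys p" "b \<in> keys q"
      using keys_mult[of p q] m by blast
    then show ?thesis
      using Poly_Mapping.keys_add[of a b] assms by fastforce
  qed
  then show ?thesis by simp
qed

lemma mpoly_ring_ring: "ring (mpoly_ring X :: ('x, 'k::field) mpoly ring)"
proof (rule ringI)
  show "abelian_group (mpoly_ring X :: ('x, 'k) mpoly ring)"
  proof (rule abelian_groupI)
    fix p :: "('x, 'k) mpoly"
    assume "p \<in> carrier (mpoly_ring X)"
    then show "\<exists>q \<in> carrier (mpoly_ring X). q \<oplus>\<^bsub>mpoly_ring X\<^esub> p = \<zero>\<^bsub>mpoly_ring X\<^esub>"
      by (intro bexI[of _ "- p"] mpoly_carrier_uminus) simp_all
  next
    fix p q :: "('x, 'k) mpoly"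
    assume "p \<in> carrier (mpoly_ring X)" "q \<in> carrier (mpoly_ring X)"
    then show "p \<oplus>\<^bsub>mpoly_ring X\<^esub> q \<in> carrier (mpoly_ring X)"
      using mpoly_carrier_add[of p X q] by simp
  qed (simp_all add: add_ac)
  show "Group.monoid (mpoly_ring X :: ('x, 'k) mpoly ring)"
  proof (rule monoidI)
    fix p q :: "('x, 'k) mpoly"
    assume "p \<in> carrier (mpoly_ring X)" "q \<in> carrier (mpoly_ring X)"
    then show "p \<otimes>\<^bsub>mpoly_ring X\<^esub> q \<in> carrier (mpoly_ring X)"
      using mpoly_carrier_mult[of p X q] by simp
  qed (simp_all add: mult_ac)
qed (simp_all add: algebra_simps)

lemma mpoly_ideal_add:
  fixes p q :: "('x, 'k::field) mpoly"
  assumes "ideal I (mpoly_ring X)" "p \<in> I" "q \<in> I"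
  shows "p + q \<in> I"
proof -
  interpret ideal I "mpoly_ring X" by fact
  show "p + q \<in> I" using additive_subgroup.a_closed[OF is_additive_subgroup assms(2,3)] by simp
qed

section \<open>Ideals spanned by differences of equivalent monomials\<close>

text \<open>
  For an equivalence relation \<open>R\<close> on monomials, a polynomial whose coefficients sum to \<open>0\<close> over
  every class of \<open>R\<close> is a linear combination of differences of equivalent monomials.  Testing
  against all \<open>R\<close>-invariant weights, rather than only against the indicators of the classes, avoids
  any discussion of classes when polynomials are multiplied.
\<close>

definition null_ideal ::
    "'x set \<Rightarrow> (('x \<Rightarrow>\<^sub>0 nat) \<Rightarrow> ('x \<Rightarrow>\<^sub>0 nat) \<Rightarrow> bool) \<Rightarrow> ('x, 'k::field) mpoly set" where
  "null_ideal X R = {p \<in> carrier (mpoly_ring X).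
    \<forall>\<phi>. (\<forall>u v. R u v \<longrightarrow> \<phi> u = \<phi> v) \<longrightarrow> lin_ext \<phi> p = 0}"

lemma null_idealD:
  assumes "p \<in> null_ideal X R" "\<And>u v. R u v \<Longrightarrow> \<phi> u = \<phi> v"
  shows "lin_ext \<phi> p = 0"
  using assms by (simp add: null_ideal_def)

text \<open>
  If \<open>R\<close> is compatible with multiplication by monomials, the shift of an invariant weight is again
  invariant, so closure under products follows from \<open>lin_ext_times\<close>.
\<close>

lemma ideal_null_ideal:
  assumes "\<And>u v w. R u v \<Longrightarrow> keys w \<subseteq> X \<Longrightarrow> R (u + w) (v + w)"
  shows "ideal (null_ideal X R) (mpoly_ring X :: ('x, 'k::field) mpoly ring)"
proof (rule idealI)
  let ?P = "mpoly_ring X :: ('x, 'k) mpoly ring"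
  interpret ring ?P by (rule mpoly_ring_ring)
  show "ring ?P" by (rule mpoly_ring_ring)
  have minus: "\<ominus>\<^bsub>?P\<^esub> p = - p" if "p \<in> carrier ?P" for p
    using that mpoly_carrier_uminus[of p X] by (intro minus_equality) simp_all
  show "subgroup (null_ideal X R) (add_monoid ?P)"
  proof
    fix p q :: "('x, 'k) mpoly"
    assume "p \<in> null_ideal X R" "q \<in> null_ideal X R"
    then show "p \<otimes>\<^bsub>add_monoid ?P\<^esub> q \<in> null_ideal X R"
      using mpoly_carrier_add[of p X q] by (simp add: null_ideal_def)
  next
    fix p :: "('x, 'k) mpoly"
    assume "p \<in> null_ideal X R"
    then show "inv\<^bsub>add_monoid ?P\<^esub> p \<in> null_ideal X R"
      using mpoly_carrier_uminus[of p X] minus[of p]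
      by (simp add: null_ideal_def a_inv_def)
  qed (auto simp: null_ideal_def)
  have times: "p * q \<in> null_ideal X R"
    if p: "p \<in> null_ideal X R" and q: "q \<in> carrier ?P" for p q :: "('x, 'k) mpoly"
  proof -
    have "lin_ext \<phi> (p * q) = 0" if \<phi>: "\<forall>u v. R u v \<longrightarrow> \<phi> u = \<phi> v" for \<phi>
    proof -
      have "lin_ext (\<lambda>m. \<phi> (m + w)) p = 0" if "w \<in> keys q" for w
        using p q that \<phi> assms by (auto simp: null_ideal_def)
      then show ?thesis by (simp add: lin_ext_times)
    qed
    then show ?thesis
      using p q mpoly_carrier_mult[of p X q] by (simp add: null_ideal_def)
  qed
  show "p \<otimes>\<^bsub>?P\<^esub> q \<in> null_ideal X R" if "p \<in> null_ideal X R" "q \<in> carrier ?P" for p q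
    using times[OF that] by simp
  show "q \<otimes>\<^bsub>?P\<^esub> p \<in> null_ideal X R" if "p \<in> null_ideal X R" "q \<in> carrier ?P" for p q
    using times[OF that] by (simp add: mult.commute)
qed

lemma binomial_carrier:
  assumes "keys u \<subseteq> X" "keys v \<subseteq> X"
  shows "mmonom u - mmonom v \<in> carrier (mpoly_ring X :: ('x, 'k::field) mpoly ring)"
  using assms keys_diff[of "mmonom u :: ('x, 'k) mpoly" "mmonom v"] by (auto simp: mmonom_def)

lemma lin_ext_mmonom [simp]: "lin_ext \<phi> (mmonom u) = \<phi> u"
  by (simp add: mmonom_def)

text \<open>
  The indicator of the class of \<open>u\<close> takes the value \<open>1\<close> at \<open>u\<close>; since \<open>1 \<noteq> 0\<close> in a field, it separates
  \<open>u\<close> from every monomial outside its class.  Hence the null ideal remembers the relation.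
\<close>

lemma binomial_in_null_ideal_iff:
  assumes "equivp R" "keys u \<subseteq> X" "keys v \<subseteq> X"
  shows "mmonom u - mmonom v \<in> (null_ideal X R :: ('x, 'k::field) mpoly set) \<longleftrightarrow> R u v"
proof
  assume *: "mmonom u - mmonom v \<in> (null_ideal X R :: ('x, 'k) mpoly set)"
  let ?\<phi> = "\<lambda>m. of_bool (R u m) :: 'k"
  have "lin_ext ?\<phi> (mmonom u - mmonom v) = 0"
  proof (rule null_idealD[OF *])
    fix m m' assume "R m m'"
    then have "R u m = R u m'"
      using assms(1) by (meson equivp_symp equivp_transp)
    then show "?\<phi> m = ?\<phi> m'" by (rule arg_cong)
  qed
  then show "R u v"
    using equivp_reflp[OF assms(1), of u] by (cases "R u v") simp_all
qed (use assms binomial_carrier[of u X v] in \<open>simp add: null_ideal_def\<close>)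

text \<open>
  Choose one representative in each class and replace every monomial of \<open>p\<close> by its representative.
  The result is \<open>0\<close>, because the coefficients over each class cancel, and the difference to \<open>p\<close> is a
  combination of differences of equivalent monomials.
\<close>

lemma null_ideal_subset:
  assumes R: "equivp R" and I: "ideal I (mpoly_ring X :: ('x, 'k::field) mpoly ring)"
    and binomials: "\<And>u v. R u v \<Longrightarrow> keys u \<subseteq> X \<Longrightarrow> keys v \<subseteq> X \<Longrightarrow> mmonom u - mmonom v \<in> I"
  shows "null_ideal X R \<subseteq> I"
proof
  fix p :: "('x, 'k) mpoly"
  assume p: "p \<in> null_ideal X R"
  interpret I: ideal I "mpoly_ring X" by fact
  \<comment> \<open>\<open>R\<close> may relate monomials over \<open>X\<close> to others, so the representative has to be chosen over \<open>X\<close>.\<close>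
  define r where "r m = (SOME v. R m v \<and> keys v \<subseteq> X)" for m
  have r: "R m (r m)" "keys (r m) \<subseteq> X" if "keys m \<subseteq> X" for m
    using someI[of "\<lambda>v. R m v \<and> keys v \<subseteq> X" m] that equivp_reflp[OF R] by (auto simp: r_def)
  have r_cong: "r u = r v" if "R u v" for u v
    using that R unfolding r_def by (metis equivp_symp equivp_transp)
  have reps: "(\<Sum>m \<in> keys p. single (r m) (lookup p m)) = 0"
  proof (rule poly_mapping_eqI)
    fix y
    have "lookup (\<Sum>m \<in> keys p. single (r m) (lookup p m)) y = lin_ext (\<lambda>m. 1 when r m = y) p"
      by (rule lookup_sum_single_image)
    also have "\<dots> = 0"
      using p r_cong by (auto simp: null_ideal_def)
    finally show "lookup (\<Sum>m \<in> keys p. single (r m) (lookup p m)) y = lookup 0 y" by simp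
  qed
  have "p = (\<Sum>m \<in> keys p. single m (lookup p m)) - (\<Sum>m \<in> keys p. single (r m) (lookup p m))"
    by (simp add: reps poly_mapping_sum_single[symmetric])
  also have "\<dots> = (\<Sum>m \<in> keys p. single 0 (lookup p m) * (mmonom m - mmonom (r m)))"
    by (simp add: sum_subtractf[symmetric] mmonom_def right_diff_distrib mult_single)
  also have "\<dots> \<in> I"
  proof -
    have summand: "single 0 (lookup p m) * (mmonom m - mmonom (r m)) \<in> I" if "m \<in> keys p" for m
    proof -
      have "mmonom m - mmonom (r m) \<in> I"
        using that p r binomials by (auto simp: null_ideal_def)
      moreover have "single 0 (lookup p m) \<in> carrier (mpoly_ring X)"
        by simp
      ultimately show ?thesis
        using I.I_l_closed by (simp del: mpoly_ring_simps(1))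
    qed
    have "(\<Sum>m \<in> A. single 0 (lookup p m) * (mmonom m - mmonom (r m))) \<in> I"
      if "A \<subseteq> keys p" for A
      using finite_subset[OF that finite_keys] that
    proof (induction A rule: finite_induct)
      case empty
      then show ?case using additive_subgroup.zero_closed[OF I.is_additive_subgroup] by simp
    next
      case (insert m A)
      then show ?case using summand mpoly_ideal_add[OF I] by simp
    qed
    then show ?thesis by blast
  qed
  finally show "p \<in> I" .
qed

section \<open>The stable set ideal as the null ideal of the fibres\<close>

text \<open>
  The image of the indeterminate of \<open>S\<close> in the stable set ring is a monomial, and \<open>set_exponent S\<close> is its
  exponent; \<open>image_exponent\<close> extends this to all monomials \<open>m\<close>.  The exponent of \<open>s\<close> in the image is
  the degree of \<open>m\<close>, and the exponent of \<open>t\<^sub>j\<close> counts the factors of \<open>m\<close> whose stable set contains \<open>j\<close>.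
\<close>

definition set_exponent :: "'v set \<Rightarrow> ('v ts_var \<Rightarrow>\<^sub>0 nat)" where
  "set_exponent S = single Svar 1 + (\<Sum>j \<in> S. single (Tvar j) 1)"

definition image_exponent :: "('v set \<Rightarrow>\<^sub>0 nat) \<Rightarrow> ('v ts_var \<Rightarrow>\<^sub>0 nat)" where
  "image_exponent m = (\<Sum>S \<in> keys m. \<Sum>_ < lookup m S. set_exponent S)"

lemma mmonom_add: "mmonom (u + v) = mmonom u * mmonom v"
  by (simp add: mmonom_def mult_single)

lemma mmonom_sum: "mmonom (\<Sum>x \<in> A. f x) = (\<Prod>x \<in> A. mmonom (f x))"
proof (induction A rule: infinite_finite_induct)
  case (insert x A)
  then show ?case by (simp add: mmonom_add)
qed (simp_all add: mmonom_def)

lemma stable_gen_eq_mmonom: "stable_gen S = mmonom (set_exponent S)"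
  by (simp add: stable_gen_def set_exponent_def mvar_def mmonom_add mmonom_sum)

lemma mpoly_subst_stable_gen:
  "mpoly_subst stable_gen p = (\<Sum>m \<in> keys p. single (image_exponent m) (lookup p m))"
proof -
  have "(\<Prod>S \<in> keys m. stable_gen S ^ lookup m S) = (mmonom (image_exponent m) :: ('a ts_var, 'b) mpoly)"
    for m :: "'a set \<Rightarrow>\<^sub>0 nat"
    by (simp add: image_exponent_def mmonom_sum stable_gen_eq_mmonom)
  then show ?thesis
    by (simp add: mpoly_subst_def mconst_def mmonom_def mult_single)
qed

lemma lookup_image_exponent:
  "lookup (image_exponent m) y = lin_ext (\<lambda>S. lookup (set_exponent S) y) m"
  by (simp add: image_exponent_def lookup_sum lin_ext_def)

lemma image_exponent_add: "image_exponent (u + v) = image_exponent u + image_exponent v"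
  by (rule poly_mapping_eqI) (simp add: lookup_image_exponent lookup_add)

lemma lookup_set_exponent_Svar [simp]: "lookup (set_exponent S) Svar = 1"
  by (simp add: set_exponent_def lookup_add lookup_sum lookup_single)

lemma lookup_set_exponent_Tvar [simp]:
  "finite S \<Longrightarrow> lookup (set_exponent S) (Tvar i) = of_bool (i \<in> S)"
  by (simp add: set_exponent_def lookup_add lookup_sum lookup_single when_def)

lemma lookup_image_exponent_Svar: "lookup (image_exponent m) Svar = monom_deg m"
  by (simp add: lookup_image_exponent lin_ext_def monom_deg_def)

definition same_fibre :: "('v set \<Rightarrow>\<^sub>0 nat) \<Rightarrow> ('v set \<Rightarrow>\<^sub>0 nat) \<Rightarrow> bool" where
  "same_fibre u v \<longleftrightarrow> image_exponent u = image_exponent v"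

lemma equivp_same_fibre: "equivp same_fibre"
  by (rule equivpI) (auto simp: reflp_def symp_def transp_def same_fibre_def)

lemma same_fibre_monom_deg: "same_fibre u v \<Longrightarrow> monom_deg u = monom_deg v"
  by (metis same_fibre_def lookup_image_exponent_Svar)

text \<open>
  The coefficient of a monomial in the image of \<open>p\<close> is the sum of the coefficients of \<open>p\<close> over one
  fibre, and a weight that is constant on the fibres factors through the image.
\<close>

lemma stable_set_ideal_eq_null_ideal:
  "stable_set_ideal G = (null_ideal (stable_sets G) same_fibre :: ('v set, 'k::field) mpoly set)"
proof -
  have "mpoly_subst stable_gen p = 0 \<longleftrightarrow>
      (\<forall>\<phi>. (\<forall>u v. same_fibre u v \<longrightarrow> \<phi> u = \<phi> v) \<longrightarrow> lin_ext \<phi> p = 0)"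
    (is "?l \<longleftrightarrow> ?r") for p :: "('v set, 'k) mpoly"
  proof
    assume ?l
    show ?r
    proof (intro allI impI)
      fix \<phi> :: "('v set \<Rightarrow>\<^sub>0 nat) \<Rightarrow> 'k"
      assume \<phi>: "\<forall>u v. same_fibre u v \<longrightarrow> \<phi> u = \<phi> v"
      define \<psi> where "\<psi> y = \<phi> (SOME m. image_exponent m = y)" for y
      have \<psi>: "\<psi> (image_exponent m) = \<phi> m" for m
      proof -
        have "image_exponent (SOME m'. image_exponent m' = image_exponent m) = image_exponent m"
          by (rule someI) simp
        then have "same_fibre (SOME m'. image_exponent m' = image_exponent m) m"
          by (simp only: same_fibre_def)
        then show ?thesis unfolding \<psi>_def using \<phi> by blast
      qed
      have "lin_ext \<phi> p = lin_ext \<psi> (mpoly_subst stable_gen p)"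
        by (simp add: mpoly_subst_stable_gen lin_ext_sum \<psi> lin_ext_def[of \<phi>])
      then show "lin_ext \<phi> p = 0" using \<open>?l\<close> by simp
    qed
  next
    assume r: ?r
    show ?l
    proof (rule poly_mapping_eqI)
      fix y
      have "lin_ext (\<lambda>m. 1 when image_exponent m = y) p = 0"
        by (rule r[rule_format]) (simp add: same_fibre_def)
      then show "lookup (mpoly_subst stable_gen p) y = lookup 0 y"
        by (simp add: mpoly_subst_stable_gen lookup_sum_single_image)
    qed
  qed
  then show ?thesis
    by (simp add: stable_set_ideal_def a_kernel_def' null_ideal_def stable_set_ring_def
        generated_subalgebra_def)
qed

section \<open>Quadratic moves between monomials\<close>

text \<open>
  A move replaces two factors \<open>b\<close> of a monomial by two factors \<open>b'\<close> with the same image.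
\<close>

definition quadratic_move :: "'v set set \<Rightarrow> ('v set \<Rightarrow>\<^sub>0 nat) \<Rightarrow> ('v set \<Rightarrow>\<^sub>0 nat) \<Rightarrow> bool" where
  "quadratic_move X u v \<longleftrightarrow> (\<exists>w b b'. keys w \<subseteq> X \<and> keys b \<subseteq> X \<and> keys b' \<subseteq> X \<and>
    monom_deg b = 2 \<and> monom_deg b' = 2 \<and> same_fibre b b' \<and> u = w + b \<and> v = w + b')"

abbreviation quadratic_moves :: "'v set set \<Rightarrow> ('v set \<Rightarrow>\<^sub>0 nat) \<Rightarrow> ('v set \<Rightarrow>\<^sub>0 nat) \<Rightarrow> bool" where
  "quadratic_moves X \<equiv> (quadratic_move X)\<^sup>*\<^sup>*"

lemma equivp_quadratic_moves: "equivp (quadratic_moves X)"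
proof (rule equivpI)
  have "symp (quadratic_move X)"
    unfolding symp_def quadratic_move_def same_fibre_def by metis
  then show "symp (quadratic_moves X)" by (rule symp_rtranclp)
qed (auto simp: reflp_def transp_def)

lemma quadratic_moves_add:
  assumes "quadratic_moves X u v" "keys w \<subseteq> X"
  shows "quadratic_moves X (u + w) (v + w)"
  using assms(1)
proof induction
  case (step y z)
  from \<open>quadratic_move X y z\<close> obtain w' b b' where *: "keys w' \<subseteq> X" "keys b \<subseteq> X" "keys b' \<subseteq> X"
    "monom_deg b = 2" "monom_deg b' = 2" "same_fibre b b'" "y = w' + b" "z = w' + b'"
    unfolding quadratic_move_def by blast
  have "keys (w' + w) \<subseteq> X"
    using Poly_Mapping.keys_add[of w' w] * assms(2) by blast
  moreover have "y + w = (w' + w) + b" "z + w = (w' + w) + b'"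
    using * by (simp_all add: add_ac)
  ultimately have "quadratic_move X (y + w) (z + w)"
    unfolding quadratic_move_def using * by blast
  then show ?case using step.IH by simp
qed simp

lemma quadratic_move_binomial_in_ideal:
  assumes I: "ideal I (mpoly_ring X :: ('v set, 'k::field) mpoly ring)"
    and quadratic: "{mmonom b - mmonom b' | b b'. keys b \<subseteq> X \<and> keys b' \<subseteq> X \<and>
      monom_deg b = 2 \<and> monom_deg b' = 2 \<and> b \<noteq> b' \<and> same_fibre b b'} \<subseteq> I"
    and "quadratic_move X u v"
  shows "mmonom u - mmonom v \<in> I"
proof -
  interpret I: ideal I "mpoly_ring X" by fact
  from assms(3) obtain w b b' where *: "keys w \<subseteq> X" "keys b \<subseteq> X" "keys b' \<subseteq> X"
    "monom_deg b = 2" "monom_deg b' = 2" "same_fibre b b'" "u = w + b" "v = w + b'"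
    unfolding quadratic_move_def by blast
  show ?thesis
  proof (cases "b = b'")
    case True
    then show ?thesis
      using * additive_subgroup.zero_closed[OF I.is_additive_subgroup] by simp
  next
    case False
    then have "mmonom b - mmonom b' \<in> I" using * quadratic by blast
    moreover have "mmonom w \<in> carrier (mpoly_ring X :: ('v set, 'k) mpoly ring)"
      using * by (simp add: mmonom_def)
    ultimately have "mmonom w * (mmonom b - mmonom b') \<in> I"
      using I.I_l_closed by (simp del: mpoly_ring_simps(1))
    then show ?thesis by (simp add: * mmonom_add right_diff_distrib)
  qed
qed

text \<open>
  Both sides compare two null ideals: the stable set ideal is the null ideal of \<open>same_fibre\<close>, and
  the quadratic binomials in it generate the null ideal of \<open>quadratic_moves\<close>.  As a null ideal
  determines its relation, the ideals agree exactly if the relations do.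
\<close>

lemma quadratic_iff_fibres_connected:
  fixes G :: "'v pair_pre_digraph"
  defines "X \<equiv> stable_sets G"
  shows "quadratic_stable_set_ring TYPE('k::field) G \<longleftrightarrow>
    (\<forall>u v. keys u \<subseteq> X \<longrightarrow> keys v \<subseteq> X \<longrightarrow> same_fibre u v \<longrightarrow> quadratic_moves X u v)"
    (is "?quadratic \<longleftrightarrow> ?connected")
proof
  let ?P = "mpoly_ring X :: ('v set, 'k) mpoly ring"
  let ?I = "stable_set_ideal G :: ('v set, 'k) mpoly set"
  interpret P: ring ?P by (rule mpoly_ring_ring)
  have I: "?I = null_ideal X same_fibre"
    by (simp add: X_def stable_set_ideal_eq_null_ideal)
  {
    assume ?quadratic
    then obtain B where B: "B \<subseteq> quadratic_binomials X" "?I = Idl\<^bsub>?P\<^esub> B"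
      by (auto simp: quadratic_stable_set_ring_def X_def)
    have carr: "B \<subseteq> carrier ?P"
    proof
      fix p assume "p \<in> B"
      then obtain u v where "p = mmonom u - mmonom v" "keys u \<subseteq> X" "keys v \<subseteq> X"
        using B(1) unfolding quadratic_binomials_def by blast
      then show "p \<in> carrier ?P" using binomial_carrier by blast
    qed
    let ?J = "null_ideal X (quadratic_moves X) :: ('v set, 'k) mpoly set"
    have "B \<subseteq> ?J"
    proof
      fix p assume p: "p \<in> B"
      then obtain u v where uv: "p = mmonom u - mmonom v" "keys u \<subseteq> X" "keys v \<subseteq> X"
        "monom_deg u = 2" "monom_deg v = 2"
        using B(1) unfolding quadratic_binomials_def by blast
      have "p \<in> ?I"
        using p P.genideal_self[OF carr] B(2) by blast
      then have "same_fibre u v"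
        using binomial_in_null_ideal_iff[OF equivp_same_fibre uv(2,3), where ?'k = 'k] uv(1) I by simp
      then have "quadratic_move X u v"
        unfolding quadratic_move_def using uv by (intro exI[of _ 0] exI[of _ u] exI[of _ v]) simp
      then show "p \<in> ?J"
        using binomial_in_null_ideal_iff[OF equivp_quadratic_moves uv(2,3), where ?'k = 'k] uv(1) by blast
    qed
    moreover have "ideal ?J ?P"
      by (rule ideal_null_ideal) (rule quadratic_moves_add)
    ultimately have "?I \<subseteq> ?J"
      unfolding B(2) by (intro P.genideal_minimal)
    then have subset: "null_ideal X same_fibre \<subseteq> ?J"
      unfolding I .
    show ?connected
    proof (intro allI impI)
      fix u v :: "'v set \<Rightarrow>\<^sub>0 nat"
      assume uv: "keys u \<subseteq> X" "keys v \<subseteq> X" and "same_fibre u v"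
      then have "mmonom u - mmonom v \<in> ?J"
        using binomial_in_null_ideal_iff[OF equivp_same_fibre uv, where ?'k = 'k] subset by blast
      then show "quadratic_moves X u v"
        using binomial_in_null_ideal_iff[OF equivp_quadratic_moves uv, where ?'k = 'k] by blast
    qed
  next
    assume connected: ?connected
    define B :: "('v set, 'k) mpoly set" where
      "B = {mmonom b - mmonom b' | b b'. keys b \<subseteq> X \<and> keys b' \<subseteq> X \<and>
        monom_deg b = 2 \<and> monom_deg b' = 2 \<and> b \<noteq> b' \<and> same_fibre b b'}"
    have "B \<subseteq> ?I"
    proof
      fix p assume "p \<in> B"
      then obtain b b' where b: "p = mmonom b - mmonom b'" "keys b \<subseteq> X" "keys b' \<subseteq> X"
        "same_fibre b b'"
        unfolding B_def by blast
      then show "p \<in> ?I"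
        using binomial_in_null_ideal_iff[OF equivp_same_fibre b(2,3), where ?'k = 'k] I by simp
    qed
    then have carr: "B \<subseteq> carrier ?P"
      unfolding I null_ideal_def by blast
    have ideal: "ideal (Idl\<^bsub>?P\<^esub> B) ?P"
      by (rule P.genideal_ideal[OF carr])
    have moves: "mmonom u - mmonom v \<in> Idl\<^bsub>?P\<^esub> B" if "quadratic_moves X u v" for u v
      using that
    proof induction
      case base
      then show ?case
        using additive_subgroup.zero_closed[OF ideal.axioms(1)[OF ideal]] by simp
    next
      case (step y z)
      have "mmonom y - mmonom z \<in> Idl\<^bsub>?P\<^esub> B"
        using quadratic_move_binomial_in_ideal[OF ideal _ step.hyps(2)] P.genideal_self[OF carr]
        by (simp add: B_def)
      with mpoly_ideal_add[OF ideal step.IH] show ?case by fastforce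
    qed
    have "?I = Idl\<^bsub>?P\<^esub> B"
    proof
      show "?I \<subseteq> Idl\<^bsub>?P\<^esub> B"
        unfolding I using null_ideal_subset[OF equivp_same_fibre ideal] connected moves by blast
      have "ideal ?I ?P"
        unfolding I by (rule ideal_null_ideal) (simp add: same_fibre_def image_exponent_add)
      then show "Idl\<^bsub>?P\<^esub> B \<subseteq> ?I"
        using \<open>B \<subseteq> ?I\<close> by (rule P.genideal_minimal)
    qed
    moreover have "B \<subseteq> quadratic_binomials X"
      unfolding B_def quadratic_binomials_def by blast
    ultimately show ?quadratic
      unfolding quadratic_stable_set_ring_def X_def by blast
  }
qed

section \<open>Kempe equivalence by recoloring two colors\<close>

text \<open>
  This relation is coarser than a Kempe switching: it allows to switch any set of components of the
  subgraph on two color classes at once, and it does not mention components.  Exchanging two colors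
  globally, exchanging two adjacent twins, and a quadratic move of monomials are all changes of
  this form.
\<close>

definition two_color_change ::
    "'v pair_pre_digraph \<Rightarrow> nat \<Rightarrow> nat \<Rightarrow> nat \<Rightarrow> ('v \<Rightarrow> nat) \<Rightarrow> ('v \<Rightarrow> nat) \<Rightarrow> bool" where
  "two_color_change H k i j f g \<longleftrightarrow> f \<in> colorings H k \<and> g \<in> colorings H k \<and>
    i \<in> {1..k} \<and> j \<in> {1..k} \<and>
    (\<forall>v \<in> pverts H. f v = g v \<or> f v \<in> {i, j} \<and> g v \<in> {i, j})"

lemma kempe_switching_imp_two_color_change:
  assumes "kempe_switching H k f g"
  obtains i j where "i \<noteq> j" "two_color_change H k i j f g"
proof -
  from assms obtain i j C where *: "f \<in> colorings H k" "g \<in> colorings H k"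
    "1 \<le> i" "i < j" "j \<le> k" "g = (\<lambda>v. if v \<in> C then transpose i j (f v) else f v)"
    unfolding kempe_switching_def by blast
  have "f v = g v \<or> f v \<in> {i, j} \<and> g v \<in> {i, j}" for v
    by (simp add: *(6) transpose_def)
  then have "two_color_change H k i j f g"
    using *(1-5) by (simp add: two_color_change_def)
  with \<open>i < j\<close> show thesis by (intro that[of i j]) simp_all
qed

lemma coloringsD:
  assumes "f \<in> colorings H k"
  shows "\<And>v. v \<in> pverts H \<Longrightarrow> f v \<in> {1..k}" "\<And>v. v \<notin> pverts H \<Longrightarrow> f v = undefined"
    "\<And>u v. (u, v) \<in> parcs H \<Longrightarrow> f u \<noteq> f v"
  using assms by (auto simp: colorings_def PiE_def extensional_def)

lemma coloringsI:
  assumes "\<And>v. v \<in> pverts H \<Longrightarrow> f v \<in> {1..k}" "\<And>v. v \<notin> pverts H \<Longrightarrow> f v = undefined"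
    "\<And>u v. (u, v) \<in> parcs H \<Longrightarrow> f u \<noteq> f v"
  shows "f \<in> colorings H k"
  using assms by (auto simp: colorings_def PiE_def extensional_def)

lemma kempe_equivalent_refl: "f \<in> colorings H k \<Longrightarrow> kempe_equivalent H k f f"
  by (simp add: kempe_equivalent_def)

lemma kempe_equivalent_trans:
  "kempe_equivalent H k f g \<Longrightarrow> kempe_equivalent H k g h \<Longrightarrow> kempe_equivalent H k f h"
  by (auto simp: kempe_equivalent_def)

text \<open>
  A set \<open>D\<close> that no edge inside \<open>A\<close> leaves contains the whole component of each of its points.
\<close>

lemma obtain_component:
  assumes "pair_graph H" "A \<subseteq> pverts H" "x \<in> A"
    and closed: "\<And>u v. u \<in> D \<Longrightarrow> v \<in> A \<Longrightarrow> (u, v) \<in> parcs H \<Longrightarrow> v \<in> D"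
    and "x \<in> D"
  obtains C where "C \<in> components H A" "x \<in> C" "C \<subseteq> A \<inter> D"
    "\<And>u v. u \<in> C \<Longrightarrow> v \<in> A \<Longrightarrow> (u, v) \<in> parcs H \<Longrightarrow> v \<in> C"
proof -
  interpret H: pair_graph H by fact
  define N where "N = with_proj H \<restriction> A"
  have verts: "verts N = A" by (simp add: N_def)
  have ends: "arcs_ends N = {e \<in> parcs H. fst e \<in> A \<and> snd e \<in> A}"
    by (auto simp: N_def arcs_ends_conv induce_subgraph_def)
  interpret N: wf_digraph N
    by unfold_locales (auto simp: N_def induce_subgraph_def)
  have sym: "symmetric N"
    using H.pair_sym_arcs unfolding symmetric_def ends by (auto simp: sym_def)
  let ?C = "N.scc_of x"
  have "?C \<in> components H A"
    using N.scc_of_in_sccs_verts[of x] \<open>x \<in> A\<close> verts by (simp add: components_def N_def)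
  moreover have "x \<in> ?C"
    using \<open>x \<in> A\<close> verts by (simp add: N.scc_of_def)
  moreover have "y \<in> A \<inter> D" if "y \<in> ?C" for y
  proof -
    from that have "x \<rightarrow>\<^sup>*\<^bsub>N\<^esub> y" by (simp add: N.scc_of_def)
    then show ?thesis
    proof (induction rule: N.reachable_induct)
      case base
      then show ?case using \<open>x \<in> A\<close> \<open>x \<in> D\<close> by simp
    next
      case (step y z)
      then show ?case using closed ends by auto
    qed
  qed
  moreover have "v \<in> ?C" if "u \<in> ?C" "v \<in> A" "(u, v) \<in> parcs H" for u v
  proof -
    have "u \<in> A" using that(1) verts by (auto simp: N.scc_of_def elim: reachable_in_vertsE)
    then have "u \<rightarrow>\<^bsub>N\<^esub> v" using that ends by simp
    then have "x \<rightarrow>\<^sup>*\<^bsub>N\<^esub> v"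
      using that(1) N.reachable_adj_trans by (auto simp: N.scc_of_def)
    then show ?thesis
      using symmetric_reachable[OF sym] by (auto simp: N.scc_of_def)
  qed
  ultimately show thesis using that[of ?C] by blast
qed

lemma switch_component:
  assumes H: "pair_graph H" and f: "f \<in> colorings H k"
    and ij: "1 \<le> i" "i < j" "j \<le> k"
    and C: "C \<in> components H {v \<in> pverts H. f v = i \<or> f v = j}"
      "C \<subseteq> {v \<in> pverts H. f v = i \<or> f v = j}"
    and closed: "\<And>u v. u \<in> C \<Longrightarrow> v \<in> pverts H \<Longrightarrow> f v = i \<or> f v = j \<Longrightarrow> (u, v) \<in> parcs H \<Longrightarrow> v \<in> C"
  shows "kempe_switching H k f (\<lambda>v. if v \<in> C then transpose i j (f v) else f v)"
    (is "kempe_switching H k f ?g")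
proof -
  interpret H: pair_graph H by fact
  have sym: "(v, u) \<in> parcs H" if "(u, v) \<in> parcs H" for u v
    using H.pair_sym_arcs that by (auto simp: symmetric_def sym_def)
  have "?g \<in> colorings H k"
  proof (rule coloringsI)
    fix v
    show "?g v \<in> {1..k}" if "v \<in> pverts H"
      using coloringsD(1)[OF f that] ij by (auto simp: transpose_def)
    show "?g v = undefined" if "v \<notin> pverts H"
      using that C(2) coloringsD(2)[OF f that] by auto
  next
    have one: "?g u \<noteq> ?g v" if "(u, v) \<in> parcs H" "u \<in> C" "v \<notin> C" for u v
    proof -
      have "f u = i \<or> f u = j" using that(2) C(2) by blast
      moreover have "\<not> (f v = i \<or> f v = j)"
        using closed[OF that(2) _ _ that(1)] that H.in_arcsD2 by blast
      ultimately show ?thesis using that by (auto simp: transpose_def)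
    qed
    fix u v assume uv: "(u, v) \<in> parcs H"
    consider "u \<in> C" "v \<in> C" | "u \<in> C" "v \<notin> C" | "u \<notin> C" "v \<in> C" | "u \<notin> C" "v \<notin> C" by blast
    then show "?g u \<noteq> ?g v"
    proof cases
      case 1
      then show ?thesis
        using coloringsD(3)[OF f uv] transpose_eq_imp_eq[of i j "f u" "f v"] by auto
    next
      case 3
      then show ?thesis using one[OF sym[OF uv]] by force
    qed (use one[OF uv] coloringsD(3)[OF f uv] in \<open>simp_all\<close>)
  qed
  then show ?thesis
    unfolding kempe_switching_def using f ij C(1) by blast
qed

text \<open>
  On the subgraph induced by the colors \<open>i\<close> and \<open>j\<close>, the set where \<open>f\<close> and \<open>g\<close> disagree is closed under
  adjacency: along an edge both colorings alternate between \<open>i\<close> and \<open>j\<close>.  So it is a union of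
  components.  Switching one of them brings \<open>f\<close> to agree with \<open>g\<close> there and changes nothing else,
  which leaves fewer vertices of disagreement.
\<close>

lemma two_color_change_imp_kempe_equivalent_less:
  assumes H: "pair_graph H" and "i < j" and "two_color_change H k i j f g"
  shows "kempe_equivalent H k f g"
  using assms(3)
proof (induction "card {v \<in> pverts H. f v \<noteq> g v}" arbitrary: f rule: less_induct)
  case less
  interpret H: pair_graph H by fact
  have f: "f \<in> colorings H k" and g: "g \<in> colorings H k" and ij: "1 \<le> i" "j \<le> k"
    and change: "\<And>v. v \<in> pverts H \<Longrightarrow> f v = g v \<or> f v \<in> {i, j} \<and> g v \<in> {i, j}"
    using less.prems by (auto simp: two_color_change_def)
  show ?case
  proof (cases "\<exists>x \<in> pverts H. f x \<noteq> g x")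
    case False
    have "f v = g v" for v
      using False coloringsD(2)[OF f, of v] coloringsD(2)[OF g, of v] by (cases "v \<in> pverts H") auto
    then have "f = g" by blast
    then show ?thesis using f by (simp add: kempe_equivalent_refl)
  next
    case True
    then obtain x where x: "x \<in> pverts H" "f x \<noteq> g x" by blast
    let ?A = "{v \<in> pverts H. f v = i \<or> f v = j}"
    let ?D = "{v \<in> pverts H. f v \<noteq> g v}"
    have "v \<in> ?D" if "u \<in> ?D" "v \<in> ?A" "(u, v) \<in> parcs H" for u v
    proof -
      have "f u \<noteq> f v" "g u \<noteq> g v"
        using coloringsD(3)[OF f that(3)] coloringsD(3)[OF g that(3)] by simp_all
      then show ?thesis using change[of u] that by auto
    qed
    then obtain C where C: "C \<in> components H ?A" "x \<in> C" "C \<subseteq> ?A \<inter> ?D"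
      "\<And>u v. u \<in> C \<Longrightarrow> v \<in> ?A \<Longrightarrow> (u, v) \<in> parcs H \<Longrightarrow> v \<in> C"
      using obtain_component[OF H, of ?A x ?D] x change[OF x(1)] by blast
    define f' where "f' = (\<lambda>v. if v \<in> C then transpose i j (f v) else f v)"
    have switch: "kempe_switching H k f f'"
      unfolding f'_def
      using C by (intro switch_component[OF H f ij(1) \<open>i < j\<close> ij(2)]) auto
    have f'_C: "f' v = g v" if "v \<in> C" for v
      using that C(3) change[of v] by (auto simp: f'_def transpose_def)
    have f'_not_C: "f' v = f v" if "v \<notin> C" for v
      using that by (simp add: f'_def)
    have "{v \<in> pverts H. f' v \<noteq> g v} \<subset> ?D"
    proof -
      have "x \<in> ?D" "x \<notin> {v \<in> pverts H. f' v \<noteq> g v}" using x C(2) f'_C by auto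
      moreover have "{v \<in> pverts H. f' v \<noteq> g v} \<subseteq> ?D" using f'_C f'_not_C by force
      ultimately show ?thesis by blast
    qed
    then have "card {v \<in> pverts H. f' v \<noteq> g v} < card ?D"
      using H.pair_finite_verts by (intro psubset_card_mono) auto
    moreover have "two_color_change H k i j f' g"
    proof -
      have "f' v = g v \<or> f' v \<in> {i, j} \<and> g v \<in> {i, j}" if "v \<in> pverts H" for v
        using change[OF that] f'_C f'_not_C by (cases "v \<in> C") auto
      then show ?thesis
        using switch less.prems by (auto simp: two_color_change_def kempe_switching_def)
    qed
    ultimately have "kempe_equivalent H k f' g" by (rule less.hyps)
    moreover have "kempe_equivalent H k f f'"
      using switch unfolding kempe_equivalent_def by (auto dest: kempe_switching_def[THEN iffD1])
    ultimately show ?thesis using kempe_equivalent_trans by blast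
  qed
qed

lemma two_color_change_imp_kempe_equivalent:
  assumes H: "pair_graph H" and change: "two_color_change H k i j f g"
  shows "kempe_equivalent H k f g"
proof (cases i j rule: linorder_cases)
  case less
  then show ?thesis using two_color_change_imp_kempe_equivalent_less[OF H] change by blast
next
  case equal
  have "f v = g v" for v
    using change equal coloringsD(2)[of f H k v] coloringsD(2)[of g H k v]
    by (cases "v \<in> pverts H") (auto simp: two_color_change_def)
  then have "f = g" by blast
  then show ?thesis using change by (simp add: kempe_equivalent_refl two_color_change_def)
next
  case greater
  have "two_color_change H k j i f g"
    using change by (auto simp: two_color_change_def)
  then show ?thesis using two_color_change_imp_kempe_equivalent_less[OF H greater] by blast
qed

section \<open>Colorings of replication graphs as monomials\<close>

text \<open>
  A color class of a replication graph meets each clique in at most one vertex, and forgetting which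
  one leaves a stable set of the original graph.  A coloring thus becomes a product of \<open>k\<close>
  indeterminates, where unused colors contribute the indeterminate of the empty set.
\<close>

definition color_support :: "('v \<times> nat) pair_pre_digraph \<Rightarrow> ('v \<times> nat \<Rightarrow> nat) \<Rightarrow> nat \<Rightarrow> 'v set" where
  "color_support H f c = fst ` {x \<in> pverts H. f x = c}"

definition coloring_monomial ::
    "('v \<times> nat) pair_pre_digraph \<Rightarrow> nat \<Rightarrow> ('v \<times> nat \<Rightarrow> nat) \<Rightarrow> ('v set \<Rightarrow>\<^sub>0 nat)" where
  "coloring_monomial H k f = (\<Sum>c \<in> {1..k}. single (color_support H f c) 1)"

lemma monom_deg_eq_lin_ext: "monom_deg m = lin_ext (\<lambda>_. 1) m"
  by (simp add: monom_deg_def lin_ext_def)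

lemma obtain_monomial_factors:
  assumes "monom_deg u = k"
  obtains S where "u = (\<Sum>c \<in> {1..k}. single (S c) 1)" "\<And>c. c \<in> {1..k} \<Longrightarrow> S c \<in> keys u"
proof -
  have "\<exists>S. u = (\<Sum>c \<in> {1..k}. single (S c) 1) \<and> (\<forall>c \<in> {1..k}. S c \<in> keys u)"
    using assms
  proof (induction k arbitrary: u)
    case 0
    then have "u = 0"
      by (intro poly_mapping_eqI) (auto simp: monom_deg_def in_keys_iff)
    then show ?case by simp
  next
    case (Suc k)
    then have "keys u \<noteq> {}" by (auto simp: monom_deg_def)
    then obtain T where T: "T \<in> keys u" by blast
    define u' where "u' = u - single T 1"
    have u: "u = u' + single T 1"
      unfolding u'_def using T
      by (intro poly_mapping_eqI) (auto simp: lookup_add lookup_minus lookup_single when_def in_keys_iff)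
    then have "monom_deg u' = k"
      using Suc.prems by (simp add: monom_deg_eq_lin_ext)
    then obtain S where S: "u' = (\<Sum>c \<in> {1..k}. single (S c) 1)" "\<forall>c \<in> {1..k}. S c \<in> keys u'"
      using Suc.IH by blast
    have "(\<Sum>c \<in> {1..k}. single ((S(Suc k := T)) c) 1) = (\<Sum>c \<in> {1..k}. single (S c) (1::nat))"
      by (intro sum.cong) auto
    then have "u = (\<Sum>c \<in> {1..Suc k}. single ((S(Suc k := T)) c) 1)"
      unfolding u S(1) by (simp add: sum.atLeast1_atMost_eq)
    moreover have "(S(Suc k := T)) c \<in> keys u" if "c \<in> {1..Suc k}" for c
    proof (cases "c = Suc k")
      case False
      with that S(2) have "S c \<in> keys u'" by auto
      then show ?thesis using False by (simp add: u in_keys_iff lookup_add)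
    qed (use T in simp)
    ultimately show ?case by blast
  qed
  with that show thesis by blast
qed

lemma sum_single_split:
  assumes "finite A" and eq: "(\<Sum>c \<in> A. single (h c) (1::nat)) = w + single S 1"
  obtains c where "c \<in> A" "h c = S" "(\<Sum>c \<in> A - {c}. single (h c) 1) = w"
proof -
  have nonzero: "lookup (\<Sum>c \<in> A. single (h c) (1::nat)) S \<noteq> 0"
    unfolding eq by (simp add: lookup_add)
  have "\<exists>c \<in> A. h c = S"
  proof (rule ccontr)
    assume "\<not> (\<exists>c \<in> A. h c = S)"
    then have "lookup (\<Sum>c \<in> A. single (h c) (1::nat)) S = 0"
      unfolding lookup_sum by (intro sum.neutral) (simp add: lookup_single)
    with nonzero show False by contradiction
  qed
  then obtain c where c: "c \<in> A" "h c = S" by blast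
  have "(\<Sum>c \<in> A - {c}. single (h c) 1) + single S 1 = w + single S 1"
    using sum.remove[OF \<open>finite A\<close> c(1), of "\<lambda>c. single (h c) (1::nat)"] c(2) eq by (simp add: add.commute)
  with c that show thesis by simp
qed

lemma lookup_sum_single_eq_card:
  "finite A \<Longrightarrow> lookup (\<Sum>c \<in> A. single (h c) (1::nat)) S = card {c \<in> A. S = h c}"
  by (simp add: lookup_sum lookup_single when_def sum.If_cases Int_def eq_commute[of S])

lemma finite_stable_set: "pair_graph G \<Longrightarrow> S \<in> stable_sets G \<Longrightarrow> finite S"
  using pair_fin_digraph.pair_finite_verts[of G]
  by (auto simp: stable_sets_def pair_graph_def pair_digraph_def intro: finite_subset)

text \<open>
  The edges of the replication graph \<open>H\<close> can be read off from \<open>G\<close>, because \<open>F\<close> is induced.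
\<close>

locale replication =
  fixes G F :: "'v pair_pre_digraph" and a :: "'v \<Rightarrow> nat" and H X
  assumes graph: "pair_graph G"
    and induced: "induced_subgraph (with_proj F) (with_proj G)"
  defines "H \<equiv> replicate_graph F a"
    and "X \<equiv> stable_sets G"
begin

sublocale G: pair_graph G by (rule graph)

lemma pverts_F: "pverts F \<subseteq> pverts G"
  using induced by (simp add: induced_subgraph_def subgraph_def)

lemma parcs_F: "(i, j) \<in> parcs F \<longleftrightarrow> i \<in> pverts F \<and> j \<in> pverts F \<and> (i, j) \<in> parcs G"
  using induced by (auto simp: induced_subgraph_def)

lemma G_sym: "(i, j) \<in> parcs G \<Longrightarrow> (j, i) \<in> parcs G"
  using G.pair_sym_arcs by (auto simp: symmetric_def sym_def)

lemma G_loopfree: "(i, i) \<notin> parcs G"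
  using G.pair_no_loops by fastforce

lemma pverts_H: "(i, p) \<in> pverts H \<longleftrightarrow> i \<in> pverts F \<and> p < a i"
  by (auto simp: H_def replicate_graph_def Let_def)

lemma parcs_H: "((i, p), (j, q)) \<in> parcs H \<longleftrightarrow>
    (i, p) \<in> pverts H \<and> (j, q) \<in> pverts H \<and> (i = j \<and> p \<noteq> q \<or> (i, j) \<in> parcs G)"
  by (auto simp: H_def replicate_graph_def Let_def parcs_F)

lemma finite_pverts_H: "finite (pverts H)"
  using finite_subset[OF pverts_F G.pair_finite_verts] by (simp add: H_def replicate_graph_def Let_def)

lemma pair_graph_H: "pair_graph H"
proof
  fix e assume "e \<in> parcs H"
  then show "fst e \<in> pverts H" "snd e \<in> pverts H" "fst e \<noteq> snd e"
    using G_loopfree by (cases e; auto simp: parcs_H)+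
next
  show "finite (pverts H)" by (rule finite_pverts_H)
  have "parcs H \<subseteq> pverts H \<times> pverts H" by (auto simp: parcs_H)
  then show "finite (parcs H)" using finite_pverts_H finite_subset by blast
  show "symmetric H"
    by (auto simp: symmetric_def sym_def parcs_H intro: G_sym)
qed

lemma coloring_inj_on_clique:
  assumes "f \<in> colorings H k" "(i, p) \<in> pverts H" "(i, q) \<in> pverts H" "f (i, p) = f (i, q)"
  shows "p = q"
  using assms coloringsD(3)[OF assms(1), of "(i, p)" "(i, q)"] by (auto simp: parcs_H)

lemma color_support_iff:
  "i \<in> color_support H f c \<longleftrightarrow> (\<exists>p. (i, p) \<in> pverts H \<and> f (i, p) = c)"
  by (force simp: color_support_def)

lemma color_support_stable: "f \<in> colorings H k \<Longrightarrow> color_support H f c \<in> X"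
  using pverts_F coloringsD(3)[of f H k]
  by (fastforce simp: X_def stable_sets_def color_support_iff parcs_H pverts_H)

lemma finite_stable: "S \<in> X \<Longrightarrow> finite S"
  using finite_stable_set[OF graph] by (simp add: X_def)

lemma keys_coloring_monomial: "f \<in> colorings H k \<Longrightarrow> keys (coloring_monomial H k f) \<subseteq> X"
  using keys_sum[of "\<lambda>c. single (color_support H f c) (1::nat)" "{1..k}"] color_support_stable
  by (fastforce simp: coloring_monomial_def)

text \<open>
  The clique of \<open>i\<close> has \<open>a i\<close> vertices with distinct colors, so exactly \<open>a i\<close> color classes meet it.
  Hence all \<open>k\<close>-colorings of \<open>H\<close> lie in the same fibre.
\<close>

lemma image_exponent_coloring_monomial:
  assumes f: "f \<in> colorings H k"
  shows "lookup (image_exponent (coloring_monomial H k f)) y =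
    (case y of Svar \<Rightarrow> k | Tvar i \<Rightarrow> if i \<in> pverts F then a i else 0)"
proof (cases y)
  case Svar
  then show ?thesis
    by (simp add: coloring_monomial_def lookup_image_exponent lin_ext_sum)
next
  case (Tvar i)
  have "lookup (image_exponent (coloring_monomial H k f)) y
      = card {c \<in> {1..k}. i \<in> color_support H f c}"
    using color_support_stable[OF f, THEN finite_stable]
    by (simp add: Tvar coloring_monomial_def lookup_image_exponent lin_ext_sum Int_def)
  also have "{c \<in> {1..k}. i \<in> color_support H f c} = (\<lambda>p. f (i, p)) ` {p. (i, p) \<in> pverts H}"
    using coloringsD(1)[OF f] by (force simp: color_support_iff)
  also have "card \<dots> = card {p. (i, p) \<in> pverts H}"
    using coloring_inj_on_clique[OF f] by (intro card_image inj_onI) auto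
  also have "\<dots> = (if i \<in> pverts F then a i else 0)"
    by (simp add: pverts_H)
  finally show ?thesis by (simp add: Tvar)
qed

lemma same_fibre_colorings:
  assumes "f \<in> colorings H k" "g \<in> colorings H k"
  shows "same_fibre (coloring_monomial H k f) (coloring_monomial H k g)"
  unfolding same_fibre_def using assms
  by (intro poly_mapping_eqI) (simp add: image_exponent_coloring_monomial)

text \<open>
  Only the factors of the two colors change.  Their images agree because the remaining factors are
  common and the two full monomials lie in the same fibre.
\<close>

lemma two_color_change_imp_quadratic_move:
  assumes change: "two_color_change H k i j f g" and "i \<noteq> j"
  shows "quadratic_move X (coloring_monomial H k f) (coloring_monomial H k g)"
proof -
  have f: "f \<in> colorings H k" and g: "g \<in> colorings H k" and ij: "i \<in> {1..k}" "j \<in> {1..k}"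
    using change by (auto simp: two_color_change_def)
  define pair :: "('v \<times> nat \<Rightarrow> nat) \<Rightarrow> ('v set \<Rightarrow>\<^sub>0 nat)" where
    "pair h = single (color_support H h i) 1 + single (color_support H h j) 1" for h
  define w where "w = (\<Sum>c \<in> {1..k} - {i, j}. single (color_support H f c) (1::nat))"
  have split: "coloring_monomial H k h
      = (\<Sum>c \<in> {1..k} - {i, j}. single (color_support H h c) 1) + pair h" for h
  proof -
    have "{1..k} - {i} - {j} = {1..k} - {i, j}" by blast
    then show ?thesis
      using ij \<open>i \<noteq> j\<close>
      by (simp add: coloring_monomial_def pair_def sum.remove[of _ i] sum.remove[of _ j] add_ac)
  qed
  have "color_support H f c = color_support H g c" if "c \<notin> {i, j}" for c
    using change that by (fastforce simp: two_color_change_def color_support_def intro!: arg_cong[of _ _ "(`) fst"])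
  then have w: "w = (\<Sum>c \<in> {1..k} - {i, j}. single (color_support H g c) 1)"
    unfolding w_def by (intro sum.cong) auto
  have fib: "same_fibre (w + pair f) (w + pair g)"
    using same_fibre_colorings[OF f g] split[of f] split[of g] w w_def by simp
  then have "same_fibre (pair f) (pair g)"
    by (simp add: same_fibre_def image_exponent_add)
  moreover have "keys w \<subseteq> X"
    using keys_sum[of "\<lambda>c. single (color_support H f c) (1::nat)" "{1..k} - {i, j}"]
      color_support_stable[OF f] by (fastforce simp: w_def)
  moreover have "keys (pair h) \<subseteq> X" if "h \<in> colorings H k" for h
    using color_support_stable[OF that] Poly_Mapping.keys_add by (fastforce simp: pair_def)
  moreover have "monom_deg (pair h) = 2" for h
    by (simp add: pair_def monom_deg_eq_lin_ext)
  ultimately show ?thesis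
    unfolding quadratic_move_def using f g split[of f] split[of g] w w_def by metis
qed

lemma kempe_equivalent_imp_quadratic_moves:
  assumes "kempe_equivalent H k f g"
  shows "quadratic_moves X (coloring_monomial H k f) (coloring_monomial H k g)"
proof -
  have "(kempe_switching H k)\<^sup>*\<^sup>* f g" using assms by (simp add: kempe_equivalent_def)
  then show ?thesis
  proof induction
    case (step h h')
    from \<open>kempe_switching H k h h'\<close> obtain i j where "i \<noteq> j" "two_color_change H k i j h h'"
      by (rule kempe_switching_imp_two_color_change)
    then show ?case using two_color_change_imp_quadratic_move step.IH by (meson rtranclp.rtrancl_into_rtrancl)
  qed simp
qed

text \<open>
  Write \<open>u\<close> as a product of the indeterminates of \<open>S 1, \<dots>, S k\<close>.  The vertex \<open>i\<close> lies in exactly \<open>a i\<close> of these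
  sets, so the vertices of its clique can be numbered by their indices, and the index is the color.
\<close>

lemma obtain_coloring_of_monomial:
  assumes u: "keys u \<subseteq> X" "monom_deg u = k"
    and mult: "\<And>i. lookup (image_exponent u) (Tvar i) = (if i \<in> pverts F then a i else 0)"
  obtains f where "f \<in> colorings H k" "coloring_monomial H k f = u"
proof -
  obtain S where S: "u = (\<Sum>c \<in> {1..k}. single (S c) 1)" "\<And>c. c \<in> {1..k} \<Longrightarrow> S c \<in> keys u"
    using obtain_monomial_factors[OF u(2)] by blast
  have SX: "S c \<in> X" if "c \<in> {1..k}" for c using S(2) u(1) that by blast
  have card: "card {c \<in> {1..k}. i \<in> S c} = (if i \<in> pverts F then a i else 0)" for i
  proof -
    have "lookup (image_exponent u) (Tvar i) = (\<Sum>c \<in> {1..k}. of_bool (i \<in> S c))"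
      using SX[THEN finite_stable] by (simp add: S(1) lookup_image_exponent lin_ext_sum)
    then show ?thesis using mult[of i] by (simp add: Int_def)
  qed
  have "\<exists>h. bij_betw h {..<a i} {c \<in> {1..k}. i \<in> S c}" if "i \<in> pverts F" for i
    using ex_bij_betw_nat_finite[of "{c \<in> {1..k}. i \<in> S c}"] card[of i] that
    by (simp add: atLeast0LessThan)
  then obtain h where h: "\<And>i. i \<in> pverts F \<Longrightarrow> bij_betw (h i) {..<a i} {c \<in> {1..k}. i \<in> S c}"
    by metis
  define f where "f x = (if x \<in> pverts H then h (fst x) (snd x) else undefined)" for x
  have f_h: "f (i, p) = h i p" if "(i, p) \<in> pverts H" for i p
    using that by (simp add: f_def)
  have f_mem: "f (i, p) \<in> {1..k} \<and> i \<in> S (f (i, p))" if "(i, p) \<in> pverts H" for i p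
    using that h[of i] by (auto simp: f_h pverts_H dest!: bij_betwE)
  have f: "f \<in> colorings H k"
  proof (rule coloringsI)
    fix x y assume "(x, y) \<in> parcs H"
    moreover obtain i p j q where xy: "x = (i, p)" "y = (j, q)" by (cases x, cases y)
    ultimately have verts: "(i, p) \<in> pverts H" "(j, q) \<in> pverts H"
      and arc: "i = j \<and> p \<noteq> q \<or> (i, j) \<in> parcs G"
      by (simp_all add: parcs_H)
    from arc show "f x \<noteq> f y"
    proof
      assume "i = j \<and> p \<noteq> q"
      then show ?thesis
        using h[of i] verts by (auto simp: xy f_h pverts_H bij_betw_def inj_on_def)
    next
      assume "(i, j) \<in> parcs G"
      then show ?thesis
        using f_mem[OF verts(1)] f_mem[OF verts(2)] SX unfolding xy X_def stable_sets_def by force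
    qed
  next
    fix x assume "x \<in> pverts H"
    then show "f x \<in> {1..k}" using f_mem by (cases x) blast
  qed (simp add: f_def)
  have "color_support H f c = S c" if c: "c \<in> {1..k}" for c
  proof (intro equalityI subsetI)
    fix i assume "i \<in> color_support H f c"
    then show "i \<in> S c" using f_mem by (auto simp: color_support_iff)
  next
    fix i assume i: "i \<in> S c"
    have "i \<in> pverts F"
    proof (rule ccontr)
      assume "i \<notin> pverts F"
      then have "{c \<in> {1..k}. i \<in> S c} = {}" using card[of i] by simp
      then show False using i c by blast
    qed
    moreover have "c \<in> h i ` {..<a i}"
      using bij_betw_imp_surj_on[OF h[OF \<open>i \<in> pverts F\<close>]] i c by blast
    ultimately show "i \<in> color_support H f c"
      by (auto simp: color_support_iff f_h pverts_H)
  qed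
  then have "coloring_monomial H k f = u"
    unfolding coloring_monomial_def S(1) by (intro sum.cong) auto
  with f that show thesis by blast
qed

text \<open>
  A move replaces the supports \<open>S\<close>, \<open>T\<close> of two colors \<open>c\<close>, \<open>d\<close> by stable sets \<open>S'\<close>, \<open>T'\<close> covering every
  vertex equally often.  Over a vertex in both \<open>S\<close> and \<open>T\<close> both colors are kept; over a vertex in just
  one of them, which then lies in just one of \<open>S'\<close> and \<open>T'\<close>, the single affected vertex of its clique
  takes the color prescribed by \<open>S'\<close> or \<open>T'\<close>.  The new coloring is proper because \<open>S'\<close> and \<open>T'\<close> are
  stable, and it differs from the old one by a two color change.
\<close>

lemma quadratic_move_lift:
  assumes f: "f \<in> colorings H k" and "quadratic_move X (coloring_monomial H k f) v"
  obtains g where "kempe_equivalent H k f g" "coloring_monomial H k g = v"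
proof -
  from assms(2) obtain w b b' where move: "keys b \<subseteq> X" "keys b' \<subseteq> X"
    "monom_deg b = 2" "monom_deg b' = 2" "same_fibre b b'"
    "coloring_monomial H k f = w + b" "v = w + b'"
    unfolding quadratic_move_def by blast
  have two: "\<exists>S T. m = single S 1 + single T 1 \<and> S \<in> X \<and> T \<in> X"
    if "monom_deg m = 2" "keys m \<subseteq> X" for m :: "'v set \<Rightarrow>\<^sub>0 nat"
  proof -
    obtain S where S: "m = (\<Sum>c \<in> {1..2::nat}. single (S c) 1)" "\<And>c. c \<in> {1..2} \<Longrightarrow> S c \<in> keys m"
      using obtain_monomial_factors[OF \<open>monom_deg m = 2\<close>] by blast
    have "{1..2::nat} = {1, 2}" by auto
    then have "m = single (S 1) 1 + single (S 2) 1" using S(1) by simp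
    moreover have "S 1 \<in> X" "S 2 \<in> X" using S(2)[of 1] S(2)[of 2] that(2) by auto
    ultimately show ?thesis by blast
  qed
  obtain S T where ST: "b = single S 1 + single T 1" "S \<in> X" "T \<in> X"
    using two[OF move(3,1)] by blast
  obtain S' T' where ST': "b' = single S' 1 + single T' 1" "S' \<in> X" "T' \<in> X"
    using two[OF move(4,2)] by blast
  have balance: "of_bool (i \<in> S) + of_bool (i \<in> T) = (of_bool (i \<in> S') + of_bool (i \<in> T') :: nat)" for i
  proof -
    have "lookup (image_exponent b) (Tvar i) = lookup (image_exponent b') (Tvar i)"
      using move(5) by (simp add: same_fibre_def)
    then show ?thesis
      using ST ST' finite_stable by (simp add: lookup_image_exponent)
  qed
  have both: "i \<in> S \<and> i \<in> T \<longleftrightarrow> i \<in> S' \<and> i \<in> T'" and any: "i \<in> S \<or> i \<in> T \<longleftrightarrow> i \<in> S' \<or> i \<in> T'" for i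
    using balance[of i] by (auto simp: of_bool_def split: if_splits)
  have "(\<Sum>c \<in> {1..k}. single (color_support H f c) 1) = (w + single T 1) + single S 1"
    using move(6) ST(1) by (simp add: coloring_monomial_def add_ac)
  then obtain c where c: "c \<in> {1..k}" "color_support H f c = S"
    "(\<Sum>c \<in> {1..k} - {c}. single (color_support H f c) 1) = w + single T 1"
    using sum_single_split[of "{1..k}" "color_support H f"] by blast
  obtain d where d: "d \<in> {1..k} - {c}" "color_support H f d = T"
    "(\<Sum>c \<in> {1..k} - {c} - {d}. single (color_support H f c) 1) = w"
    using sum_single_split[OF _ c(3)] by blast
  define g where "g x = (if x \<in> pverts H \<and> f x \<in> {c, d} \<and> \<not> (fst x \<in> S \<and> fst x \<in> T)
      then if fst x \<in> S' then c else d else f x)" for x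
  have cd: "c \<noteq> d" using d by blast
  have S_iff: "i \<in> S \<longleftrightarrow> (\<exists>p. (i, p) \<in> pverts H \<and> f (i, p) = c)" for i
    using c(2) color_support_iff by blast
  have T_iff: "i \<in> T \<longleftrightarrow> (\<exists>p. (i, p) \<in> pverts H \<and> f (i, p) = d)" for i
    using d(2) color_support_iff by blast
  have g_c: "i \<in> S'" if "(i, p) \<in> pverts H" "g (i, p) = c" for i p
    using that cd both[of i] S_iff[of i] by (auto simp: g_def split: if_splits)
  have g_d: "i \<in> T'" if "(i, p) \<in> pverts H" "g (i, p) = d" for i p
    using that cd both[of i] any[of i] S_iff[of i] T_iff[of i] by (auto simp: g_def split: if_splits)
  have g_cases: "g x = f x \<or> f x \<in> {c, d} \<and> g x \<in> {c, d}" for x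
    by (auto simp: g_def)
  have g: "g \<in> colorings H k"
  proof (rule coloringsI)
    fix x assume "x \<in> pverts H"
    then show "g x \<in> {1..k}"
      using g_cases[of x] coloringsD(1)[OF f, of x] c(1) d(1) by auto
  next
    fix x assume "x \<notin> pverts H"
    then show "g x = undefined" using coloringsD(2)[OF f] by (simp add: g_def)
  next
    fix x y assume xy: "(x, y) \<in> parcs H"
    moreover obtain i p j q where [simp]: "x = (i, p)" "y = (j, q)" by (cases x, cases y)
    ultimately have verts: "(i, p) \<in> pverts H" "(j, q) \<in> pverts H"
      and arc: "i = j \<and> p \<noteq> q \<or> (i, j) \<in> parcs G"
      by (simp_all add: parcs_H)
    have fxy: "f x \<noteq> f y" using coloringsD(3)[OF f xy] .
    show "g x \<noteq> g y"
    proof (cases "f x \<in> {c, d} \<and> f y \<in> {c, d}")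
      case False
      then show ?thesis using g_cases[of x] g_cases[of y] fxy by auto
    next
      case True
      from arc show ?thesis
      proof
        assume "i = j \<and> p \<noteq> q"
        then have "i \<in> S \<and> i \<in> T" using True fxy verts S_iff[of i] T_iff[of i] by auto
        then show ?thesis using fxy \<open>i = j \<and> p \<noteq> q\<close> by (simp add: g_def)
      next
        assume ij: "(i, j) \<in> parcs G"
        have "g x \<in> {c, d}" "g y \<in> {c, d}" using True g_cases[of x] g_cases[of y] by auto
        moreover have "\<not> (g x = c \<and> g y = c)"
          using g_c verts ij ST'(2) by (auto simp: X_def stable_sets_def)
        moreover have "\<not> (g x = d \<and> g y = d)"
          using g_d verts ij ST'(3) by (auto simp: X_def stable_sets_def)
        ultimately show ?thesis by auto
      qed
    qed
  qed
  have "two_color_change H k c d f g"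
    unfolding two_color_change_def using f g c(1) d(1) g_cases by force
  then have equivalent: "kempe_equivalent H k f g"
    by (rule two_color_change_imp_kempe_equivalent[OF pair_graph_H])
  have supp_c: "color_support H g c = S'"
  proof (intro equalityI subsetI)
    fix i assume i: "i \<in> S'"
    show "i \<in> color_support H g c"
    proof (cases "i \<in> S \<and> i \<in> T")
      case True
      then obtain p where "(i, p) \<in> pverts H" "f (i, p) = c" using S_iff by blast
      then show ?thesis using True by (auto simp: color_support_iff g_def)
    next
      case False
      then obtain p where "(i, p) \<in> pverts H" "f (i, p) \<in> {c, d}" using any[of i] i S_iff T_iff by blast
      then show ?thesis using False i by (auto simp: color_support_iff g_def)
    qed
  qed (use g_c in \<open>auto simp: color_support_iff\<close>)
  have supp_d: "color_support H g d = T'"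
  proof (intro equalityI subsetI)
    fix i assume i: "i \<in> T'"
    show "i \<in> color_support H g d"
    proof (cases "i \<in> S \<and> i \<in> T")
      case True
      then obtain p where "(i, p) \<in> pverts H" "f (i, p) = d" using T_iff by blast
      then show ?thesis using True by (auto simp: color_support_iff g_def)
    next
      case False
      then obtain p where "(i, p) \<in> pverts H" "f (i, p) \<in> {c, d}" using any[of i] i S_iff T_iff by blast
      moreover have "i \<notin> S'" using False i both[of i] by blast
      ultimately show ?thesis using False by (auto simp: color_support_iff g_def)
    qed
  qed (use g_d in \<open>auto simp: color_support_iff\<close>)
  have supp: "color_support H g e = color_support H f e" if "e \<notin> {c, d}" for e
  proof -
    have "g x = e \<longleftrightarrow> f x = e" for x using that g_cases[of x] by auto
    then show ?thesis by (simp add: color_support_def)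
  qed
  have "(\<Sum>e \<in> {1..k} - {c} - {d}. single (color_support H g e) 1) = w"
    unfolding d(3)[symmetric] by (intro sum.cong) (auto simp: supp)
  then have "coloring_monomial H k g = w + (single S' 1 + single T' 1)"
    using c(1) d(1) supp_c supp_d
    by (simp add: coloring_monomial_def sum.remove[of _ c] sum.remove[of _ d] add_ac)
  with equivalent that show thesis using move(7) ST'(1) by simp
qed

text \<open>
  A transposition of colors is a two color change, and transpositions generate all permutations.
\<close>

lemma permute_colors_kempe_equivalent:
  assumes "\<pi> permutes {1..k}" "f \<in> colorings H k"
  defines "recolor \<equiv> \<lambda>\<pi> x. if x \<in> pverts H then \<pi> (f x) else f x"
  shows "kempe_equivalent H k f (recolor \<pi>)"
proof -
  have "finite {1..k}" by simp
  with assms(1) show ?thesis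
  proof (induction rule: permutes_induct)
    case id
    have "recolor id = f" by (auto simp: recolor_def)
    then show ?case using kempe_equivalent_refl[OF assms(2)] by (simp only:)
  next
    case (swap c d \<pi>)
    have f: "recolor \<pi> \<in> colorings H k" using swap.IH by (simp add: kempe_equivalent_def)
    have t: "recolor (transpose c d \<circ> \<pi>) x = (if x \<in> pverts H then transpose c d (recolor \<pi> x) else undefined)" for x
      using coloringsD(2)[OF assms(2)] by (simp add: recolor_def)
    have arcs: "x \<in> pverts H \<and> y \<in> pverts H" if "(x, y) \<in> parcs H" for x y
      using that by (cases x; cases y) (simp add: parcs_H)
    have "recolor (transpose c d \<circ> \<pi>) \<in> colorings H k"
    proof (rule coloringsI)
      fix x y assume xy: "(x, y) \<in> parcs H"
      show "recolor (transpose c d \<circ> \<pi>) x \<noteq> recolor (transpose c d \<circ> \<pi>) y"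
        using coloringsD(3)[OF f xy] arcs[OF xy] transpose_eq_imp_eq unfolding t by metis
    next
      fix x assume "x \<in> pverts H"
      then show "recolor (transpose c d \<circ> \<pi>) x \<in> {1..k}"
        using coloringsD(1)[OF f] swap.hyps unfolding t by (auto simp: transpose_def)
    qed (simp add: t)
    moreover have "recolor \<pi> x = recolor (transpose c d \<circ> \<pi>) x \<or>
        recolor \<pi> x \<in> {c, d} \<and> recolor (transpose c d \<circ> \<pi>) x \<in> {c, d}" if "x \<in> pverts H" for x
      using that unfolding t by (simp add: transpose_def)
    ultimately have "two_color_change H k c d (recolor \<pi>) (recolor (transpose c d \<circ> \<pi>))"
      using f swap.hyps by (simp add: two_color_change_def)
    then show ?case
      using swap.IH two_color_change_imp_kempe_equivalent[OF pair_graph_H] kempe_equivalent_trans by blast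
  qed
qed

text \<open>
  The two colorings differ by permutations within the cliques.  If they disagree at a vertex \<open>(i, p)\<close>,
  the color wanted there is used by \<open>f\<close> at another vertex \<open>(i, q)\<close> of the same clique.  These two
  vertices are adjacent twins, so exchanging their colors is a two color change.  It repairs the
  first vertex and spoils no other, since the second one was wrong as well.
\<close>

lemma equal_supports_kempe_equivalent:
  assumes "f \<in> colorings H k" and g: "g \<in> colorings H k"
    and "\<And>c. c \<in> {1..k} \<Longrightarrow> color_support H f c = color_support H g c"
  shows "kempe_equivalent H k f g"
  using assms(1,3)
proof (induction "card {x \<in> pverts H. f x \<noteq> g x}" arbitrary: f rule: less_induct)
  case less
  have f: "f \<in> colorings H k" and supp: "\<And>c. c \<in> {1..k} \<Longrightarrow> color_support H f c = color_support H g c"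
    using less.prems by auto
  show ?case
  proof (cases "\<exists>x \<in> pverts H. f x \<noteq> g x")
    case False
    have "f x = g x" for x
      using False coloringsD(2)[OF f, of x] coloringsD(2)[OF g, of x] by (cases "x \<in> pverts H") auto
    then have "f = g" by blast
    then show ?thesis using f by (simp add: kempe_equivalent_refl)
  next
    case True
    then obtain i p where ip: "(i, p) \<in> pverts H" "f (i, p) \<noteq> g (i, p)" by auto
    have gk: "g (i, p) \<in> {1..k}" using coloringsD(1)[OF g ip(1)] .
    have "i \<in> color_support H g (g (i, p))" using ip by (auto simp: color_support_iff)
    then obtain q where iq: "(i, q) \<in> pverts H" "f (i, q) = g (i, p)"
      using supp[OF gk] color_support_iff by metis
    have pq: "p \<noteq> q" using ip iq by auto
    have giq: "f (i, q) \<noteq> g (i, q)"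
      using coloring_inj_on_clique[OF g ip(1) iq(1)] iq(2) pq by auto
    define f' where "f' = f((i, p) := f (i, q), (i, q) := f (i, p))"
    let ?t = "transpose (i, p) (i, q)"
    have f't: "f' z = f (?t z)" for z by (simp add: f'_def transpose_def)
    have t_verts: "?t z \<in> pverts H" if "z \<in> pverts H" for z
      using that ip(1) iq(1) by (simp add: transpose_def)
    have f': "f' \<in> colorings H k"
    proof (rule coloringsI)
      fix x assume "x \<in> pverts H"
      then show "f' x \<in> {1..k}"
        using coloringsD(1)[OF f, of x] coloringsD(1)[OF f ip(1)] coloringsD(1)[OF f iq(1)]
        by (auto simp: f'_def)
    next
      fix x assume "x \<notin> pverts H"
      then show "f' x = undefined" using coloringsD(2)[OF f] ip iq by (auto simp: f'_def)
    next
      fix x y assume xy: "(x, y) \<in> parcs H"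
      have "(?t x, ?t y) \<in> parcs H"
        using xy ip(1) iq(1) pq by (cases x; cases y) (auto simp: parcs_H transpose_def split: if_splits)
      then show "f' x \<noteq> f' y" using coloringsD(3)[OF f] unfolding f't by blast
    qed
    have "two_color_change H k (f (i, p)) (f (i, q)) f f'"
      using f f' coloringsD(1)[OF f ip(1)] coloringsD(1)[OF f iq(1)]
      by (auto simp: two_color_change_def f'_def)
    then have "kempe_equivalent H k f f'"
      by (rule two_color_change_imp_kempe_equivalent[OF pair_graph_H])
    moreover have "kempe_equivalent H k f' g"
    proof (rule less.hyps)
      have "{x \<in> pverts H. f' x \<noteq> g x} \<subset> {x \<in> pverts H. f x \<noteq> g x}"
        using ip iq giq pq by (auto simp: f'_def split: if_splits)
      then show "card {x \<in> pverts H. f' x \<noteq> g x} < card {x \<in> pverts H. f x \<noteq> g x}"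
        using finite_pverts_H by (intro psubset_card_mono) auto
      show "color_support H f' c = color_support H g c" if "c \<in> {1..k}" for c
      proof -
        have sub: "color_support H h c \<subseteq> color_support H h' c" if "\<And>z. h z = h' (?t z)" for h h'
        proof
          fix l assume "l \<in> color_support H h c"
          then obtain x where x: "x \<in> pverts H" "h x = c" "l = fst x" by (auto simp: color_support_def)
          have "fst (?t x) = fst x" by (simp add: transpose_def)
          then show "l \<in> color_support H h' c"
            using x that t_verts[OF x(1)] unfolding color_support_def by (intro image_eqI[of _ _ "?t x"]) auto
        qed
        have "color_support H f' c = color_support H f c"
          using sub[of f' f] sub[of f f'] f't by auto
        then show ?thesis using supp[OF that] by blast
      qed
    qed (rule f')
    ultimately show ?thesis by (rule kempe_equivalent_trans)
  qed
qed

text \<open>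
  Equal monomials have the same factors up to order, so a permutation of the colors matches the
  supports of the two colorings.
\<close>

lemma equal_monomials_kempe_equivalent:
  assumes f: "f \<in> colorings H k" and g: "g \<in> colorings H k"
    and eq: "coloring_monomial H k f = coloring_monomial H k g"
  shows "kempe_equivalent H k f g"
proof -
  have "image_mset (color_support H f) (mset_set {1..k}) = image_mset (color_support H g) (mset_set {1..k})"
  proof (rule multiset_eqI)
    fix S
    have "card {c \<in> {1..k}. S = color_support H f c} = card {c \<in> {1..k}. S = color_support H g c}"
      using arg_cong[OF eq, of "\<lambda>m. lookup m S"]
        lookup_sum_single_eq_card[of "{1..k}" "color_support H f" S]
        lookup_sum_single_eq_card[of "{1..k}" "color_support H g" S]
      unfolding coloring_monomial_def by simp
    then show "count (image_mset (color_support H f) (mset_set {1..k})) S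
        = count (image_mset (color_support H g) (mset_set {1..k})) S"
      by (simp add: count_image_mset')
  qed
  then obtain \<pi> where \<pi>: "\<pi> permutes {1..k}"
    "\<forall>c \<in> {1..k}. color_support H f c = color_support H g (\<pi> c)"
    using image_mset_eq_implies_permutes[of "{1..k}"] by blast
  define f' where "f' = (\<lambda>x. if x \<in> pverts H then \<pi> (f x) else f x)"
  have equivalent: "kempe_equivalent H k f f'"
    unfolding f'_def by (rule permute_colors_kempe_equivalent[OF \<pi>(1) f])
  have "color_support H f' c = color_support H g c" if "c \<in> {1..k}" for c
  proof -
    have "c \<in> \<pi> ` {1..k}"
      using permutes_image[OF \<pi>(1)] that by simp
    then obtain e where e: "e \<in> {1..k}" "\<pi> e = c" by blast
    have "color_support H f' c = color_support H f e"
      using e(2) permutes_inj[OF \<pi>(1)] by (auto simp: color_support_def f'_def inj_eq)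
    then show ?thesis using \<pi>(2) e by simp
  qed
  then have "kempe_equivalent H k f' g"
    using equivalent g by (intro equal_supports_kempe_equivalent) (auto simp: kempe_equivalent_def)
  with equivalent show ?thesis by (rule kempe_equivalent_trans)
qed

text \<open>
  Lifting the moves one at a time leads from \<open>f\<close> to some coloring with the monomial of \<open>g\<close>, which need
  not be \<open>g\<close> itself; \<open>equal_monomials_kempe_equivalent\<close> closes the gap.
\<close>

lemma quadratic_moves_imp_kempe_equivalent:
  assumes f: "f \<in> colorings H k" and g: "g \<in> colorings H k"
    and moves: "quadratic_moves X (coloring_monomial H k f) (coloring_monomial H k g)"
  shows "kempe_equivalent H k f g"
proof -
  have "\<exists>h. kempe_equivalent H k f h \<and> coloring_monomial H k h = v"
    if "quadratic_moves X (coloring_monomial H k f) v" for v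
    using that
  proof induction
    case base
    then show ?case using f kempe_equivalent_refl by blast
  next
    case (step v v')
    then obtain h where h: "kempe_equivalent H k f h" "coloring_monomial H k h = v" by blast
    then obtain h' where "kempe_equivalent H k h h'" "coloring_monomial H k h' = v'"
      using quadratic_move_lift[of h k v'] step.hyps(2) by (auto simp: kempe_equivalent_def)
    then show ?case using h kempe_equivalent_trans by blast
  qed
  then obtain h where h: "kempe_equivalent H k f h" "coloring_monomial H k h = coloring_monomial H k g"
    using moves by blast
  then have "kempe_equivalent H k h g"
    using g by (intro equal_monomials_kempe_equivalent) (auto simp: kempe_equivalent_def)
  with h show ?thesis using kempe_equivalent_trans by blast
qed

end

lemma induced_subgraph_on:
  assumes "pair_graph G" "W \<subseteq> pverts G"
  shows "induced_subgraph
    (with_proj \<lparr>pverts = W, parcs = {e \<in> parcs G. fst e \<in> W \<and> snd e \<in> W}\<rparr>) (with_proj G)"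
proof -
  interpret pair_graph G by fact
  show ?thesis
    using assms(2) wf_digraph
    by (auto simp: induced_subgraph_def subgraph_def compatible_def wf_digraph_def)
qed

section \<open>Quadratic stable set rings and Kempe equivalence\<close>

theorem quadratic_iff_kempe:
  assumes G: "pair_graph (G :: 'v pair_pre_digraph)"
  shows "quadratic_stable_set_ring TYPE('k::field) G \<longleftrightarrow>
    (\<forall>F H k. induced_subgraph (with_proj F) (with_proj G) \<longrightarrow> is_replication_graph H F \<longrightarrow>
       chromatic_number H \<le> k \<longrightarrow>
       (\<forall>f \<in> colorings H k. \<forall>g \<in> colorings H k. kempe_equivalent H k f g))"
    (is "_ \<longleftrightarrow> ?kempe")
proof
  assume quadratic: "quadratic_stable_set_ring TYPE('k) G"
  show ?kempe
  proof (intro allI impI ballI)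
    fix F H k f g
    assume F: "induced_subgraph (with_proj F) (with_proj G)" and "is_replication_graph H F"
      and f: "f \<in> colorings H k" and g: "g \<in> colorings H k"
    then obtain a where H: "H = replicate_graph F a" by (auto simp: is_replication_graph_def)
    interpret replication G F a H "stable_sets G"
      by (rule replication.intro) (use G F H in simp_all)
    show "kempe_equivalent H k f g"
      using quadratic_iff_fibres_connected[of G, where ?'k = 'k] quadratic
        quadratic_moves_imp_kempe_equivalent[OF f g]
        keys_coloring_monomial[OF f] keys_coloring_monomial[OF g] same_fibre_colorings[OF f g] by blast
  qed
next
  assume kempe: ?kempe
  have "quadratic_moves (stable_sets G) u v"
    if u: "keys u \<subseteq> stable_sets G" and v: "keys v \<subseteq> stable_sets G" and uv: "same_fibre u v" for u v
  proof -
    \<comment> \<open>The common image of \<open>u\<close> and \<open>v\<close> prescribes the clique sizes; cliques of size \<open>0\<close> are removed by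
      passing to the induced subgraph on \<open>W\<close>.\<close>
    define a where "a i = lookup (image_exponent u) (Tvar i)" for i
    define W where "W = {i \<in> pverts G. 0 < a i}"
    define F where "F = \<lparr>pverts = W, parcs = {e \<in> parcs G. fst e \<in> W \<and> snd e \<in> W}\<rparr>"
    have F: "induced_subgraph (with_proj F) (with_proj G)"
      unfolding F_def by (rule induced_subgraph_on[OF G]) (auto simp: W_def)
    define H where "H = replicate_graph F a"
    have repl: "is_replication_graph H F"
      unfolding is_replication_graph_def H_def by (auto simp: F_def W_def)
    interpret replication G F a H "stable_sets G"
      by (rule replication.intro) (use G F H_def in simp_all)
    define k where "k = monom_deg u"
    have mult: "lookup (image_exponent u) (Tvar i) = (if i \<in> pverts F then a i else 0)" for i
    proof (cases "i \<in> pverts G")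
      case True
      then show ?thesis by (auto simp: a_def F_def W_def)
    next
      case False
      have "i \<notin> S" "finite S" if "S \<in> keys u" for S
        using that u False finite_stable by (auto simp: stable_sets_def)
      then have "lookup (image_exponent u) (Tvar i) = 0"
        by (simp add: lookup_image_exponent lin_ext_def)
      then show ?thesis using False by (simp add: F_def W_def)
    qed
    obtain f where f: "f \<in> colorings H k" "coloring_monomial H k f = u"
      using obtain_coloring_of_monomial[OF u _ mult] k_def by blast
    obtain g where g: "g \<in> colorings H k" "coloring_monomial H k g = v"
      using obtain_coloring_of_monomial[OF v, of k] same_fibre_monom_deg[OF uv] uv mult k_def
      unfolding same_fibre_def by metis
    have "chromatic_number H \<le> k"
      unfolding chromatic_number_def by (rule Least_le) (use f in blast)
    then have "kempe_equivalent H k f g" using kempe F repl f g by blast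
    then show ?thesis using kempe_equivalent_imp_quadratic_moves f g by blast
  qed
  then show "quadratic_stable_set_ring TYPE('k) G"
    using quadratic_iff_fibres_connected[of G, where ?'k = 'k] by blast
qed

theorem theorem1p1:
  fixes n :: nat and G :: "nat pair_pre_digraph"
  assumes "pair_graph G" and "pverts G = {1..n}"
  shows "quadratic_stable_set_ring TYPE('k::field) G \<longleftrightarrow>
    (\<forall>F H k. induced_subgraph (with_proj F) (with_proj G) \<longrightarrow> is_replication_graph H F \<longrightarrow>
       chromatic_number H \<le> k \<longrightarrow>
       (\<forall>f \<in> colorings H k. \<forall>g \<in> colorings H k. kempe_equivalent H k f g))"
  by (rule quadratic_iff_kempe[OF assms(1)])

end
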